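(* Let $M^m$ be a compact PNMC biharmonic submanifold in $\mathbb{S}^n$, $m\geq 5$. If the mean curvature $f$ of $M$ satisfies $f^2\geq \frac{4}{m}$, then $M$ is PMC.
   Context: All manifolds are smooth and connected. $\mathbb{S}^n\subset\mathbb{R}^{n+1}$ is the unit Euclidean sphere. Let $\varphi:M^m\to N$ be the inclusion of an $m$-dimensional submanifold in a Riemannian manifold $N$, with mean curvature vector field $H$ (so $mH$ is the trace of the second fundamental form) and mean curvature $f=|H|$. $M$ is biharmonic if $\Delta H+\operatorname{trace}R^N(d\varphi(\cdot),H)d\varphi(\cdot)=0$, where $\Delta V=-\operatorname{trace}\nabla^2V$ is the rough Laplacian on sections of $\varphi^{-1}(TN)$ and $R^N(X,Y)=[\nabla_X,\nabla_Y]-\nabla_{[X,Y]}$. $M$ is PNMC if $f>0$ everywhere and $\nabla^\perp(H/f)=0$, where $\nabla^\perp$ is the normal connection; $M$ is PMC if $\nabla^\perp H=0$. *)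

theory Defs
  imports "HOL-Analysis.Analysis"
begin

text \<open>Meant for open \<open>U\<close> only, since the derivative is not taken within \<open>U\<close>.\<close>

primrec Ck_on :: "nat \<Rightarrow> ('a::euclidean_space \<Rightarrow> 'b::euclidean_space) \<Rightarrow> 'a set \<Rightarrow> bool" where
  "Ck_on 0 f U \<longleftrightarrow> continuous_on U f"
| "Ck_on (Suc k) f U \<longleftrightarrow>
     (\<forall>x\<in>U. f differentiable (at x)) \<and>
     (\<forall>v. Ck_on k (\<lambda>x. frechet_derivative f (at x) v) U)"

definition smooth_on :: "('a::euclidean_space \<Rightarrow> 'b::euclidean_space) \<Rightarrow> 'a set \<Rightarrow> bool" where
  "smooth_on f U \<longleftrightarrow> (\<forall>k. Ck_on k f U)"

text \<open>Submanifolds are given by slice charts: near each point of \<open>M\<close> there is a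
  diffeomorphism between open sets of the ambient space that carries \<open>M\<close> to an
  \<open>m\<close>-dimensional linear subspace.\<close>

definition smooth_submanifold :: "nat \<Rightarrow> 'a::euclidean_space set \<Rightarrow> bool" where
  "smooth_submanifold m M \<longleftrightarrow>
     (\<forall>p\<in>M. \<exists>U (V::'a set) E \<Phi> \<Psi>. open U \<and> p \<in> U \<and> open V \<and> subspace E \<and> dim E = m \<and>
        homeomorphism U V \<Phi> \<Psi> \<and> smooth_on \<Phi> U \<and> smooth_on \<Psi> V \<and>
        \<Phi> ` (M \<inter> U) = E \<inter> V)"

definition tangent_space :: "'a::euclidean_space set \<Rightarrow> 'a \<Rightarrow> 'a set" where
  "tangent_space M p =
     {v. \<exists>\<gamma>::real \<Rightarrow> 'a. range \<gamma> \<subseteq> M \<and> \<gamma> 0 = p \<and> (\<gamma> has_vector_derivative v) (at 0)}"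

definition orth_proj :: "'a::euclidean_space set \<Rightarrow> 'a \<Rightarrow> 'a" where
  "orth_proj S v = (THE u. u \<in> S \<and> (\<forall>w\<in>S. orthogonal (v - u) w))"

definition orthonormal_basis :: "'a::euclidean_space set \<Rightarrow> 'a set \<Rightarrow> bool" where
  "orthonormal_basis S E \<longleftrightarrow>
     E \<subseteq> S \<and> pairwise orthogonal E \<and> (\<forall>e\<in>E. norm e = 1) \<and> span E = S"

text \<open>The metric trace of a bilinear map on \<open>S\<close>; it does not depend on the basis chosen.\<close>

definition trace_on ::
    "'a::euclidean_space set \<Rightarrow> ('a \<Rightarrow> 'a \<Rightarrow> 'b::real_vector) \<Rightarrow> 'b" where
  "trace_on S B = (\<Sum>e \<in> (SOME E. orthonormal_basis S E). B e e)"

text \<open>Throughout, \<open>M \<subseteq> N\<close> are submanifolds of the Euclidean space with the induced metrics,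
  and \<open>d\<phi>\<close> for the inclusion \<open>\<phi>\<close> of \<open>M\<close> in \<open>N\<close> is the inclusion of tangent spaces. Vector
  fields along \<open>M\<close> are maps on the ambient space of which only the values on \<open>M\<close> matter. The
  Frechet derivative at \<open>p\<close> within \<open>M\<close> is determined only on the tangent space of \<open>M\<close> at \<open>p\<close>;
  it is applied to no other vectors.

  \<open>nabla N M V p X\<close> is the derivative at \<open>p\<close>, in the direction \<open>X\<close> tangent to \<open>M\<close>, of a
  section \<open>V\<close> of the pull-back to \<open>M\<close> of the tangent bundle of \<open>N\<close>. The Levi-Civita
  connection of an isometrically embedded \<open>N\<close> is the tangential part of the flat one, so
  \<open>nabla N N\<close> and \<open>nabla M M\<close> are the Levi-Civita connections of \<open>N\<close> and \<open>M\<close>, and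
  \<open>nabla N M\<close> is the pull-back connection.\<close>

definition nabla ::
    "'a::euclidean_space set \<Rightarrow> 'a set \<Rightarrow> ('a \<Rightarrow> 'a) \<Rightarrow> 'a \<Rightarrow> 'a \<Rightarrow> 'a" where
  "nabla N M V p X = orth_proj (tangent_space N p) (frechet_derivative V (at p within M) X)"

text \<open>A canonical smooth extension of a tangent vector \<open>X\<close> at a point of \<open>M\<close> to a tangent
  vector field on \<open>M\<close>. The tensors below are evaluated on such extensions; their values at the
  point do not depend on the extensions chosen.\<close>

definition extension :: "'a::euclidean_space set \<Rightarrow> 'a \<Rightarrow> ('a \<Rightarrow> 'a)" where
  "extension M X = (\<lambda>q. orth_proj (tangent_space M q) X)"

definition lie_bracket ::
    "'a::euclidean_space set \<Rightarrow> ('a \<Rightarrow> 'a) \<Rightarrow> ('a \<Rightarrow> 'a) \<Rightarrow> 'a \<Rightarrow> 'a" where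
  "lie_bracket N X Y p =
     frechet_derivative Y (at p within N) (X p) - frechet_derivative X (at p within N) (Y p)"

definition curvature_field ::
    "'a::euclidean_space set \<Rightarrow> ('a \<Rightarrow> 'a) \<Rightarrow> ('a \<Rightarrow> 'a) \<Rightarrow> ('a \<Rightarrow> 'a) \<Rightarrow> 'a \<Rightarrow> 'a" where
  "curvature_field N X Y Z p =
     nabla N N (\<lambda>q. nabla N N Z q (Y q)) p (X p)
     - nabla N N (\<lambda>q. nabla N N Z q (X q)) p (Y p)
     - nabla N N Z p (lie_bracket N X Y p)"

definition curvature ::
    "'a::euclidean_space set \<Rightarrow> 'a \<Rightarrow> 'a \<Rightarrow> 'a \<Rightarrow> 'a \<Rightarrow> 'a" where
  "curvature N p X Y Z = curvature_field N (extension N X) (extension N Y) (extension N Z) p"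

definition second_covariant_derivative ::
    "'a::euclidean_space set \<Rightarrow> 'a set \<Rightarrow> ('a \<Rightarrow> 'a) \<Rightarrow> 'a \<Rightarrow> 'a \<Rightarrow> 'a \<Rightarrow> 'a" where
  "second_covariant_derivative N M V p X Y =
     nabla N M (\<lambda>q. nabla N M V q (extension M Y q)) p X
     - nabla N M V p (nabla M M (extension M Y) p X)"

definition rough_laplacian ::
    "'a::euclidean_space set \<Rightarrow> 'a set \<Rightarrow> ('a \<Rightarrow> 'a) \<Rightarrow> 'a \<Rightarrow> 'a" where
  "rough_laplacian N M V p =
     - trace_on (tangent_space M p) (second_covariant_derivative N M V p)"

definition normal_space :: "'a::euclidean_space set \<Rightarrow> 'a set \<Rightarrow> 'a \<Rightarrow> 'a set" where
  "normal_space N M p = {v \<in> tangent_space N p. \<forall>w \<in> tangent_space M p. orthogonal v w}"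

definition second_fundamental_form ::
    "'a::euclidean_space set \<Rightarrow> 'a set \<Rightarrow> 'a \<Rightarrow> 'a \<Rightarrow> 'a \<Rightarrow> 'a" where
  "second_fundamental_form N M p X Y =
     orth_proj (normal_space N M p) (nabla N M (extension M Y) p X)"

definition mean_curvature_vector ::
    "nat \<Rightarrow> 'a::euclidean_space set \<Rightarrow> 'a set \<Rightarrow> 'a \<Rightarrow> 'a" where
  "mean_curvature_vector m N M p =
     trace_on (tangent_space M p) (second_fundamental_form N M p) /\<^sub>R real m"

definition mean_curvature ::
    "nat \<Rightarrow> 'a::euclidean_space set \<Rightarrow> 'a set \<Rightarrow> 'a \<Rightarrow> real" where
  "mean_curvature m N M p = norm (mean_curvature_vector m N M p)"

definition normal_connection ::
    "'a::euclidean_space set \<Rightarrow> 'a set \<Rightarrow> ('a \<Rightarrow> 'a) \<Rightarrow> 'a \<Rightarrow> 'a \<Rightarrow> 'a" where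
  "normal_connection N M \<xi> p X = orth_proj (normal_space N M p) (nabla N M \<xi> p X)"

definition parallel_normal ::
    "'a::euclidean_space set \<Rightarrow> 'a set \<Rightarrow> ('a \<Rightarrow> 'a) \<Rightarrow> bool" where
  "parallel_normal N M \<xi> \<longleftrightarrow>
     (\<forall>p\<in>M. \<forall>X \<in> tangent_space M p. normal_connection N M \<xi> p X = 0)"

definition biharmonic :: "nat \<Rightarrow> 'a::euclidean_space set \<Rightarrow> 'a set \<Rightarrow> bool" where
  "biharmonic m N M \<longleftrightarrow>
     (\<forall>p\<in>M. rough_laplacian N M (mean_curvature_vector m N M) p
        + trace_on (tangent_space M p)
            (\<lambda>X Y. curvature N p X (mean_curvature_vector m N M p) Y) = 0)"

definition PMC :: "nat \<Rightarrow> 'a::euclidean_space set \<Rightarrow> 'a set \<Rightarrow> bool" where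
  "PMC m N M \<longleftrightarrow> parallel_normal N M (mean_curvature_vector m N M)"

definition PNMC :: "nat \<Rightarrow> 'a::euclidean_space set \<Rightarrow> 'a set \<Rightarrow> bool" where
  "PNMC m N M \<longleftrightarrow>
     (\<forall>p\<in>M. mean_curvature m N M p > 0) \<and>
     parallel_normal N M (\<lambda>p. mean_curvature_vector m N M p /\<^sub>R mean_curvature m N M p)"

end

theory Submission
  imports Defs
begin

text \<open>Write \<open>H = f \<xi>\<close> and let \<open>A\<close> be the shape operator in the direction of the parallel unit
  normal field \<open>\<xi>\<close>. The curvature term of the biharmonic equation in the sphere is \<open>- m H\<close>, so
  the \<open>\<xi>\<close>-component of the equation is \<open>L f = (|A|\<^sup>2 - m) f\<close> with \<open>L\<close> the trace of the Hessian, and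
  its tangential component is, by the traced Codazzi equation, \<open>A (grad f) = - (m/2) f grad f\<close>.
  Where \<open>grad f \<noteq> 0\<close>, this eigenvalue, \<open>tr A = m f\<close> and \<open>f\<^sup>2 \<ge> 4/m\<close> force
  \<open>|A|\<^sup>2 \<ge> m\<^sup>2 f\<^sup>2 (m + 8) / (4 (m - 1)) > m\<close>. At a maximum of \<open>f\<close>, however, \<open>L f \<le> 0\<close> gives
  \<open>|A|\<^sup>2 \<le> m\<close>. Hence \<open>grad f\<close> vanishes near every maximum point, so the set of maximum points is
  open as well as closed, \<open>f\<close> is constant, and \<open>H\<close> is parallel.\<close>

section \<open>Functions of class \<open>C\<^sup>k\<close> within a set\<close>

text \<open>Slice charts enter only through local retractions; all geometry is then expressed by the
  orthogonal projection \<open>P q\<close> onto the tangent space and its derivative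
  \<open>dP\<close>. The obstacle is that a derivative within M is determined only on tangent
  vectors. Hence \<open>Ck_within\<close> asks for some derivative with C^k values, and values are
  compared only on tangent vectors. For tangent Y, the field that sends q to \<open>P q Y\<close>
  has zero covariant derivative at p. So the plain iterated derivative of a function along such
  fields is already its Hessian, and connection terms never appear. The factor -m/2 arises because
  the tangential part of the traced second derivative of f \<xi> is -2 A (grad f) - f div A, where
  the Codazzi equation gives div A = m grad f. With f^2 at least 4/m, the square of the eigenvalue
  -(m/2) f is at least m by itself, and the other eigenvalues add at least 9. This uniform gap above
  m lets continuity of |A|^2 carry the information from a maximum point to a neighbourhood, where
  only the gradient alternative remains.\<close>

primrec Ck_within ::
    "nat \<Rightarrow> ('a::real_normed_vector \<Rightarrow> 'b::real_normed_vector) \<Rightarrow> 'a set \<Rightarrow> bool" where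
  "Ck_within 0 f A \<longleftrightarrow> continuous_on A f"
| "Ck_within (Suc k) f A \<longleftrightarrow>
     (\<exists>f'. (\<forall>x\<in>A. (f has_derivative f' x) (at x within A)) \<and> (\<forall>v. Ck_within k (\<lambda>x. f' x v) A))"

lemma Ck_within_SucI:
  assumes "\<And>x. x \<in> A \<Longrightarrow> (f has_derivative f' x) (at x within A)"
    and "\<And>v. Ck_within k (\<lambda>x. f' x v) A"
  shows "Ck_within (Suc k) f A"
  using assms by auto

lemma Ck_within_SucE:
  assumes "Ck_within (Suc k) f A"
  obtains f' where "\<And>x. x \<in> A \<Longrightarrow> (f has_derivative f' x) (at x within A)"
    and "\<And>v. Ck_within k (\<lambda>x. f' x v) A"
  using assms by (simp, blast)

lemma Ck_within_cong:
  assumes "\<And>x. x \<in> A \<Longrightarrow> f x = g x"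
  shows "Ck_within k f A \<longleftrightarrow> Ck_within k g A"
proof (cases k)
  case 0
  then show ?thesis using assms by (simp cong: continuous_on_cong)
next
  case (Suc j)
  have "(f has_derivative f') (at x within A) \<longleftrightarrow> (g has_derivative f') (at x within A)"
    if "x \<in> A" for f' x
    using assms that by (auto elim: has_derivative_transform[rotated 2])
  then show ?thesis
    unfolding Suc by simp
qed

lemma Ck_within_eqI:
  assumes "Ck_within k g A" "\<And>x. x \<in> A \<Longrightarrow> f x = g x"
  shows "Ck_within k f A"
  using assms Ck_within_cong by metis

lemma Ck_within_imp_continuous_on: "Ck_within k f A \<Longrightarrow> continuous_on A f"
  by (cases k) (simp, metis Ck_within_SucE has_derivative_continuous_on)

lemma Ck_within_Suc_imp: "Ck_within (Suc k) f A \<Longrightarrow> Ck_within k f A"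
proof (induction k arbitrary: f)
  case 0
  then show ?case unfolding Ck_within.simps(1) by (rule Ck_within_imp_continuous_on)
next
  case (Suc k)
  obtain f' where "\<And>x. x \<in> A \<Longrightarrow> (f has_derivative f' x) (at x within A)"
    "\<And>v. Ck_within (Suc k) (\<lambda>x. f' x v) A"
    using Suc.prems by (rule Ck_within_SucE) blast
  then show ?case using Suc.IH by (intro Ck_within_SucI[of A f f']) blast+
qed

lemma Ck_within_subset: "Ck_within k f A \<Longrightarrow> B \<subseteq> A \<Longrightarrow> Ck_within k f B"
proof (induction k arbitrary: f)
  case 0
  then show ?case by (auto intro: continuous_on_subset)
next
  case (Suc k)
  obtain f' where f': "\<And>x. x \<in> A \<Longrightarrow> (f has_derivative f' x) (at x within A)"
    "\<And>v. Ck_within k (\<lambda>x. f' x v) A"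
    using Suc.prems(1) by (rule Ck_within_SucE) blast
  show ?case
    using Suc.prems(2) has_derivative_subset[OF f'(1) Suc.prems(2)] Suc.IH[OF f'(2) Suc.prems(2)]
    by (intro Ck_within_SucI[of B f f']) auto
qed

lemma Ck_within_const [simp]: "Ck_within k (\<lambda>x. c) A"
  by (induction k arbitrary: c) (auto intro!: exI[of _ "\<lambda>x v. 0"])

lemma Ck_within_linear:
  assumes "bounded_linear f"
  shows "Ck_within k f A"
proof (cases k)
  case 0
  then show ?thesis using assms by (simp add: linear_continuous_on)
next
  case (Suc j)
  then show ?thesis
    using assms by (auto intro!: exI[of _ "\<lambda>x. f"] bounded_linear_imp_has_derivative)
qed

lemma Ck_within_id [simp]: "Ck_within k (\<lambda>x. x) A"
  by (rule Ck_within_linear) (rule bounded_linear_ident)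

lemma Ck_within_bounded_linear:
  assumes "bounded_linear h" "Ck_within k f A"
  shows "Ck_within k (\<lambda>x. h (f x)) A"
  using assms(2)
proof (induction k arbitrary: f)
  case 0
  then show ?case using bounded_linear.continuous_on[OF assms(1)] by auto
next
  case (Suc k)
  obtain f' where f': "\<And>x. x \<in> A \<Longrightarrow> (f has_derivative f' x) (at x within A)"
    "\<And>v. Ck_within k (\<lambda>x. f' x v) A"
    using Suc.prems by (rule Ck_within_SucE) blast
  show ?case
    using bounded_linear.has_derivative[OF assms(1) f'(1)] Suc.IH[OF f'(2)]
    by (rule Ck_within_SucI[where f' = "\<lambda>x v. h (f' x v)"])
qed

lemma Ck_within_add:
  assumes "Ck_within k f A" "Ck_within k g A"
  shows "Ck_within k (\<lambda>x. f x + g x) A"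
  using assms
proof (induction k arbitrary: f g)
  case 0
  then show ?case by (auto intro: continuous_intros)
next
  case (Suc k)
  obtain f' where f': "\<And>x. x \<in> A \<Longrightarrow> (f has_derivative f' x) (at x within A)"
    "\<And>v. Ck_within k (\<lambda>x. f' x v) A"
    using Suc.prems(1) by (rule Ck_within_SucE) blast
  obtain g' where g': "\<And>x. x \<in> A \<Longrightarrow> (g has_derivative g' x) (at x within A)"
    "\<And>v. Ck_within k (\<lambda>x. g' x v) A"
    using Suc.prems(2) by (rule Ck_within_SucE) blast
  show ?case
    using Suc.IH f' g'
    by (intro Ck_within_SucI[where f' = "\<lambda>x v. f' x v + g' x v"]) (auto intro: has_derivative_add)
qed

lemma Ck_within_uminus: "Ck_within k f A \<Longrightarrow> Ck_within k (\<lambda>x. - f x) A"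
  by (rule Ck_within_bounded_linear[OF bounded_linear_minus[OF bounded_linear_ident]])

lemma Ck_within_diff:
  assumes "Ck_within k f A" "Ck_within k g A"
  shows "Ck_within k (\<lambda>x. f x - g x) A"
  using Ck_within_add[OF assms(1) Ck_within_uminus[OF assms(2)]] by simp

lemma Ck_within_sum:
  assumes "\<And>i. i \<in> I \<Longrightarrow> Ck_within k (f i) A"
  shows "Ck_within k (\<lambda>x. \<Sum>i\<in>I. f i x) A"
  using assms
  by (induction I rule: infinite_finite_induct) (auto intro: Ck_within_add)

lemma Ck_within_bilinear:
  assumes "bounded_bilinear pr" "Ck_within k f A" "Ck_within k g A"
  shows "Ck_within k (\<lambda>x. pr (f x) (g x)) A"
  using assms(2,3)
proof (induction k arbitrary: f g)
  case 0
  then show ?case using bounded_bilinear.continuous_on[OF assms(1)] by auto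
next
  case (Suc k)
  obtain f' where f': "\<And>x. x \<in> A \<Longrightarrow> (f has_derivative f' x) (at x within A)"
    "\<And>v. Ck_within k (\<lambda>x. f' x v) A"
    using Suc.prems(1) by (rule Ck_within_SucE) blast
  obtain g' where g': "\<And>x. x \<in> A \<Longrightarrow> (g has_derivative g' x) (at x within A)"
    "\<And>v. Ck_within k (\<lambda>x. g' x v) A"
    using Suc.prems(2) by (rule Ck_within_SucE) blast
  have "Ck_within k f A" "Ck_within k g A"
    using Suc.prems Ck_within_Suc_imp by blast+
  note fg = this
  show ?case
  proof (rule Ck_within_SucI[where f' = "\<lambda>x v. pr (f x) (g' x v) + pr (f' x v) (g x)"])
    show "((\<lambda>x. pr (f x) (g x)) has_derivative (\<lambda>v. pr (f x) (g' x v) + pr (f' x v) (g x)))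
      (at x within A)" if "x \<in> A" for x
      by (rule bounded_bilinear.FDERIV[OF assms(1) f'(1)[OF that] g'(1)[OF that]])
    show "Ck_within k (\<lambda>x. pr (f x) (g' x v) + pr (f' x v) (g x)) A" for v
      by (intro Ck_within_add Suc.IH fg f'(2) g'(2))
  qed
qed

lemmas Ck_within_inner = Ck_within_bilinear[OF bounded_bilinear_inner]
lemmas Ck_within_scaleR = Ck_within_bilinear[OF bounded_bilinear_scaleR]
lemmas Ck_within_mult = Ck_within_bilinear[OF bounded_bilinear_mult]

lemma linear_euclidean_sum:
  fixes f :: "'a::euclidean_space \<Rightarrow> 'b::real_vector"
  assumes "linear f"
  shows "f x = (\<Sum>b\<in>Basis. (x \<bullet> b) *\<^sub>R f b)"
  by (subst euclidean_representation[of x, symmetric])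
    (simp only: linear_sum[OF assms] linear_scale[OF assms])

text \<open>Regularity of a family of linear maps is only known at fixed vectors; expanding V in the
  standard basis transfers it to a moving argument. The chain rule and all expressions such as
  \<open>dP q (P q b) (P q b)\<close> need this.\<close>

lemma Ck_within_linear_family:
  fixes V :: "'a::real_normed_vector \<Rightarrow> 'c::euclidean_space"
  assumes "\<And>x. x \<in> A \<Longrightarrow> linear (F x)" "\<And>b. b \<in> Basis \<Longrightarrow> Ck_within k (\<lambda>x. F x b) A" "Ck_within k V A"
  shows "Ck_within k (\<lambda>x. F x (V x)) A"
proof -
  have "Ck_within k (\<lambda>x. \<Sum>b\<in>Basis. (V x \<bullet> b) *\<^sub>R F x b) A"
    using assms by (intro Ck_within_sum Ck_within_scaleR Ck_within_inner) auto
  then show ?thesis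
    by (rule Ck_within_eqI) (use linear_euclidean_sum assms(1) in blast)
qed

lemma Ck_within_compose:
  fixes g :: "'a::real_normed_vector \<Rightarrow> 'c::euclidean_space"
  assumes "Ck_within k f B" "Ck_within k g A" "g ` A \<subseteq> B"
  shows "Ck_within k (\<lambda>x. f (g x)) A"
  using assms
proof (induction k arbitrary: f)
  case 0
  then show ?case by (auto intro: continuous_on_compose2)
next
  case (Suc k)
  obtain f' where f': "\<And>x. x \<in> B \<Longrightarrow> (f has_derivative f' x) (at x within B)"
    "\<And>v. Ck_within k (\<lambda>x. f' x v) B"
    using Suc.prems(1) by (rule Ck_within_SucE) blast
  obtain g' where g': "\<And>x. x \<in> A \<Longrightarrow> (g has_derivative g' x) (at x within A)"
    "\<And>v. Ck_within k (\<lambda>x. g' x v) A"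
    using Suc.prems(2) by (rule Ck_within_SucE) blast
  have g: "Ck_within k g A"
    using Suc.prems(2) by (rule Ck_within_Suc_imp)
  show ?case
  proof (rule Ck_within_SucI[where f' = "\<lambda>x v. f' (g x) (g' x v)"])
    fix x assume x: "x \<in> A"
    then show "((\<lambda>x. f (g x)) has_derivative (\<lambda>v. f' (g x) (g' x v))) (at x within A)"
      using has_derivative_in_compose[OF g'(1)[OF x], of f "f' (g x)"] f'(1) Suc.prems(3)
      by (meson has_derivative_subset image_subset_iff)
  next
    fix v
    show "Ck_within k (\<lambda>x. f' (g x) (g' x v)) A"
    proof (rule Ck_within_linear_family)
      show "linear (f' (g x))" if "x \<in> A" for x
        using f'(1) that Suc.prems(3) by (meson has_derivative_linear image_subset_iff)
      show "Ck_within k (\<lambda>x. f' (g x) b) A" for b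
        using Suc.IH[OF f'(2) g Suc.prems(3)] .
    qed (rule g'(2))
  qed
qed

text \<open>Serves the exponents 1/2 and -1/2, which give the norm of H and its normalisation. The
  exponent is arbitrary because differentiating lowers it by one.\<close>

lemma Ck_within_powr: "Ck_within k (\<lambda>x::real. x powr a) {0<..}"
proof (induction k arbitrary: a)
  case 0
  then show ?case by (auto intro!: continuous_intros)
next
  case (Suc k)
  show ?case
  proof (rule Ck_within_SucI[where f' = "\<lambda>x v. (a * x powr (a - 1)) * v"])
    fix x :: real assume "x \<in> {0<..}"
    then have "((\<lambda>x. x powr a) has_field_derivative a * x powr (a - 1)) (at x within {0<..})"
      by (auto intro!: derivative_eq_intros simp: powr_diff)
    then show "((\<lambda>x. x powr a) has_derivative (\<lambda>v. (a * x powr (a - 1)) * v)) (at x within {0<..})"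
      by (simp add: has_field_derivative_def)
  next
    show "Ck_within k (\<lambda>x::real. a * x powr (a - 1) * v) {0<..}" for v
      using Suc.IH by (intro Ck_within_mult) auto
  qed
qed

lemma smooth_on_imp_Ck_within:
  assumes "smooth_on f U"
  shows "Ck_within k f U"
proof -
  have "Ck_on k f U \<Longrightarrow> Ck_within k f U"
  proof (induction k arbitrary: f)
    case (Suc k)
    then show ?case
      by (intro Ck_within_SucI[where f' = "\<lambda>x. frechet_derivative f (at x)"])
        (auto simp: frechet_derivative_works intro: has_derivative_at_withinI)
  qed auto
  then show ?thesis using assms by (auto simp: smooth_on_def)
qed

lemma smooth_on_frechet_derivative:
  assumes "smooth_on f U"
  shows "\<And>x. x \<in> U \<Longrightarrow> (f has_derivative frechet_derivative f (at x)) (at x)"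
    and "smooth_on (\<lambda>x. frechet_derivative f (at x) v) U"
proof -
  have "Ck_on (Suc k) f U" for k using assms unfolding smooth_on_def by blast
  then show "\<And>x. x \<in> U \<Longrightarrow> (f has_derivative frechet_derivative f (at x)) (at x)"
    and "smooth_on (\<lambda>x. frechet_derivative f (at x) v) U"
    by (auto simp: frechet_derivative_works smooth_on_def)
qed

section \<open>Orthogonal projections\<close>

lemma orth_proj_unique:
  assumes "u \<in> S" "\<And>w. w \<in> S \<Longrightarrow> orthogonal (v - u) w" "subspace S"
  shows "orth_proj S v = u"
  unfolding orth_proj_def
proof (rule the_equality)
  show "u \<in> S \<and> (\<forall>w\<in>S. orthogonal (v - u) w)" using assms by auto
  fix u' assume u': "u' \<in> S \<and> (\<forall>w\<in>S. orthogonal (v - u') w)"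
  then have "u - u' \<in> S" using assms subspace_diff by blast
  then have "(v - u) \<bullet> (u - u') = 0" "(v - u') \<bullet> (u - u') = 0"
    using assms u' by (auto simp: orthogonal_def)
  then have "(u - u') \<bullet> (u - u') = 0" by (simp add: inner_diff_left inner_diff_right)
  then show "u' = u" by simp
qed

context
  fixes S :: "'a::euclidean_space set"
  assumes S: "subspace S"
begin

lemma orth_proj_works: "orth_proj S v \<in> S \<and> (\<forall>w\<in>S. (v - orth_proj S v) \<bullet> w = 0)"
proof -
  obtain y z where yz: "y \<in> span S" "\<And>w. w \<in> span S \<Longrightarrow> orthogonal z w" "v = y + z"
    using orthogonal_subspace_decomp_exists[of S v] by blast
  have "span S = S" using S by (simp add: span_eq_iff)
  note yz = yz[unfolded this]
  have "orth_proj S v = y" using yz(1,2) S unfolding yz(3) by (intro orth_proj_unique) auto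
  then show ?thesis using yz by (auto simp: orthogonal_def)
qed

lemma orth_proj_in: "orth_proj S v \<in> S"
  using orth_proj_works by blast

lemma orth_proj_inner: "w \<in> S \<Longrightarrow> orth_proj S v \<bullet> w = v \<bullet> w"
  using orth_proj_works[of v] by (auto simp: inner_diff_left)

lemma orth_proj_eqI:
  assumes "u \<in> S" "\<And>w. w \<in> S \<Longrightarrow> (v - u) \<bullet> w = 0"
  shows "orth_proj S v = u"
  using assms S by (intro orth_proj_unique) (auto simp: orthogonal_def)

lemma orth_proj_id: "v \<in> S \<Longrightarrow> orth_proj S v = v"
  by (rule orth_proj_eqI) auto

lemma orth_proj_eq_0: "(\<And>w. w \<in> S \<Longrightarrow> v \<bullet> w = 0) \<Longrightarrow> orth_proj S v = 0"
  by (rule orth_proj_eqI) (auto simp: subspace_0 S)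

lemma orth_proj_self_adjoint: "orth_proj S v \<bullet> w = v \<bullet> orth_proj S w"
  by (metis inner_commute orth_proj_in orth_proj_inner)

lemma linear_orth_proj: "linear (orth_proj S)"
proof (rule linearI)
  show "orth_proj S (a + b) = orth_proj S a + orth_proj S b" for a b
    by (rule orth_proj_eqI)
      (auto simp: orth_proj_in S subspace_add inner_add_left inner_diff_left orth_proj_inner)
  show "orth_proj S (c *\<^sub>R a) = c *\<^sub>R orth_proj S a" for a c
    by (rule orth_proj_eqI) (auto simp: orth_proj_in S subspace_scale inner_diff_left orth_proj_inner)
qed

lemma norm_orth_proj_le: "norm (orth_proj S v) \<le> norm v"
proof -
  have "(norm (orth_proj S v))\<^sup>2 = v \<bullet> orth_proj S v"
    by (simp add: power2_norm_eq_inner orth_proj_inner orth_proj_in)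
  also have "\<dots> \<le> norm v * norm (orth_proj S v)" by (rule norm_cauchy_schwarz)
  finally show ?thesis
    by (metis mult_right_le_imp_le norm_ge_zero power2_eq_square norm_zero order_le_less)
qed

end

section \<open>Orthonormal bases, Parseval's identity and traces\<close>

lemma orthonormal_basisD:
  assumes "orthonormal_basis S E"
  shows "finite E" "\<And>e. e \<in> E \<Longrightarrow> e \<in> S" "\<And>e. e \<in> E \<Longrightarrow> e \<bullet> e = 1"
    "\<And>e d. e \<in> E \<Longrightarrow> d \<in> E \<Longrightarrow> e \<noteq> d \<Longrightarrow> e \<bullet> d = 0" "independent E" "card E = dim S"
proof -
  have *: "pairwise orthogonal E" "0 \<notin> E" "span E = S"
    using assms by (auto simp: orthonormal_basis_def)
  then show ind: "independent E" by (rule_tac pairwise_orthogonal_independent)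
  then show "finite E" using independent_bound by blast
  show "card E = dim S" using ind * by (metis dim_span dim_eq_card_independent)
qed (use assms in \<open>auto simp: orthonormal_basis_def pairwise_def orthogonal_def norm_eq_1\<close>)

lemma orthonormal_basis_exists:
  assumes "subspace S"
  shows "orthonormal_basis S (SOME E. orthonormal_basis S E)"
proof -
  obtain B where "B \<subseteq> S" "pairwise orthogonal B" "\<And>x. x \<in> B \<Longrightarrow> norm x = 1" "span B = S"
    using orthonormal_basis_subspace[OF assms] by metis
  then show ?thesis by (metis orthonormal_basis_def someI)
qed

lemma orthonormal_basis_Basis: "orthonormal_basis UNIV (Basis :: 'a::euclidean_space set)"
  by (auto simp: orthonormal_basis_def pairwise_def orthogonal_def inner_Basis)

lemma orthonormal_basis_orth_proj:
  assumes "orthonormal_basis S E"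
  shows "orth_proj S v = (\<Sum>e\<in>E. (v \<bullet> e) *\<^sub>R e)"
proof -
  note E = orthonormal_basisD[OF assms]
  have S: "S = span E" using assms by (simp add: orthonormal_basis_def)
  then have sub: "subspace S" by (simp add: subspace_span)
  have 0: "(v - (\<Sum>e\<in>E. (v \<bullet> e) *\<^sub>R e)) \<bullet> d = 0" if "d \<in> E" for d
  proof -
    have "(\<Sum>e\<in>E. (v \<bullet> e) *\<^sub>R e) \<bullet> d = (\<Sum>e\<in>E. if e = d then v \<bullet> d else 0)"
      unfolding inner_sum_left using E that by (intro sum.cong) auto
    then show ?thesis using E that by (simp add: inner_diff_left)
  qed
  have 1: "(v - (\<Sum>e\<in>E. (v \<bullet> e) *\<^sub>R e)) \<bullet> w = 0" if "w \<in> span E" for w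
    using that by (induction rule: span_induct_alt) (auto simp: inner_add_right 0)
  show ?thesis
    using 1 S E sub by (intro orth_proj_eqI) (auto intro!: subspace_sum subspace_scale)
qed

lemma orthonormal_basis_expand:
  assumes "orthonormal_basis S E" "v \<in> S"
  shows "v = (\<Sum>e\<in>E. (v \<bullet> e) *\<^sub>R e)"
proof -
  have "subspace S" using assms(1) by (auto simp: orthonormal_basis_def)
  then show ?thesis
    using orthonormal_basis_orth_proj[OF assms(1), of v] orth_proj_id[OF _ assms(2)] by simp
qed

lemma orthonormal_basis_parseval:
  assumes "orthonormal_basis S E" "v \<in> S"
  shows "v \<bullet> w = (\<Sum>e\<in>E. (v \<bullet> e) * (w \<bullet> e))"
  by (subst orthonormal_basis_expand[OF assms]) (simp add: inner_sum_left inner_commute[of w])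

text \<open>The two sides are the trace of \<open>\<beta>\<close> over \<open>S\<close>; the left one does not involve a basis of
  \<open>S\<close>, so it depends smoothly on \<open>S\<close>.\<close>

lemma sum_orth_proj_eq_trace:
  assumes E: "orthonormal_basis S E" and F: "orthonormal_basis UNIV F"
    and "\<And>x. linear (\<beta> x)" "\<And>y. linear (\<lambda>x. \<beta> x y)"
  shows "(\<Sum>b\<in>F. \<beta> (orth_proj S b) (orth_proj S b)) = (\<Sum>e\<in>E. \<beta> e e)"
proof -
  have 1: "\<beta> (\<Sum>e\<in>E. c e *\<^sub>R e) y = (\<Sum>e\<in>E. c e *\<^sub>R \<beta> e y)" for c y
    using linear_sum[OF assms(4)[of y], of "\<lambda>e. c e *\<^sub>R e" E] linear_scale[OF assms(4)[of y]]
    by simp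
  have 2: "\<beta> x (\<Sum>e\<in>E. c e *\<^sub>R e) = (\<Sum>e\<in>E. c e *\<^sub>R \<beta> x e)" for c x
    using linear_sum[OF assms(3)[of x], of "\<lambda>e. c e *\<^sub>R e" E] linear_scale[OF assms(3)[of x]]
    by simp
  have "(\<Sum>b\<in>F. \<beta> (orth_proj S b) (orth_proj S b))
      = (\<Sum>b\<in>F. \<Sum>e\<in>E. \<Sum>d\<in>E. ((e \<bullet> b) * (d \<bullet> b)) *\<^sub>R \<beta> d e)"
    unfolding orthonormal_basis_orth_proj[OF E] 1 2 scaleR_sum_right by (simp add: inner_commute)
  also have "\<dots> = (\<Sum>e\<in>E. \<Sum>d\<in>E. (\<Sum>b\<in>F. (e \<bullet> b) * (d \<bullet> b)) *\<^sub>R \<beta> d e)"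
    unfolding scaleR_sum_left by (subst sum.swap, rule sum.cong[OF refl], rule sum.swap)
  also have "\<dots> = (\<Sum>e\<in>E. \<Sum>d\<in>E. (e \<bullet> d) *\<^sub>R \<beta> d e)"
    by (simp only: orthonormal_basis_parseval[OF F UNIV_I, symmetric])
  also have "\<dots> = (\<Sum>e\<in>E. \<Sum>d\<in>E. if d = e then \<beta> e e else 0)"
    using orthonormal_basisD[OF E] by (intro sum.cong refl) auto
  finally show ?thesis using orthonormal_basisD(1)[OF E] by simp
qed

section \<open>Retractions and tangent spaces\<close>

text \<open>\<open>tangent_space\<close> wants curves that lie in M for all times. A curve known to
  stay in M only near 0 is replaced by the constant p elsewhere; nothing but its derivative at 0 is
  required.\<close>

lemma tangent_spaceI:
  assumes "e > 0" "\<And>t. \<bar>t\<bar> < e \<Longrightarrow> \<gamma> t \<in> M" "\<gamma> 0 = p" "(\<gamma> has_vector_derivative v) (at 0)"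
  shows "v \<in> tangent_space M p"
proof -
  define \<delta> where "\<delta> = (\<lambda>t::real. if \<bar>t\<bar> < e then \<gamma> t else p)"
  have "p \<in> M" using assms(2)[of 0] assms(1,3) by simp
  then have "range \<delta> \<subseteq> M" "\<delta> 0 = p" using assms by (auto simp: \<delta>_def)
  moreover have "(\<delta> has_vector_derivative v) (at 0)"
  proof (rule has_vector_derivative_transform_within_open[OF assms(4)])
    show "open {-e<..<e}" "0 \<in> {-e<..<e}" using assms(1) by auto
    show "\<gamma> t = \<delta> t" if "t \<in> {-e<..<e}" for t using that by (auto simp: \<delta>_def)
  qed
  ultimately show ?thesis by (auto simp: tangent_space_def)
qed

lemma has_derivative_along_curve:
  assumes "(F has_derivative F') (at p within M)" "range \<gamma> \<subseteq> M" "\<gamma> 0 = p"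
    and "(\<gamma> has_vector_derivative v) (at (0::real))"
  shows "((\<lambda>t. F (\<gamma> t)) has_vector_derivative F' v) (at 0)"
proof -
  have "(F has_derivative F') (at (\<gamma> 0) within range \<gamma>)"
    using assms(1-3) by (auto intro: has_derivative_subset)
  from vector_derivative_diff_chain_within[OF assms(4) this] show ?thesis by (simp add: o_def)
qed

text \<open>A derivative within M need not be unique, and \<open>frechet_derivative\<close> picks
  one arbitrarily. Along a curve in M every choice computes the same velocity, so all choices agree
  on tangent vectors.\<close>

lemma frechet_derivative_within_eq:
  assumes "(F has_derivative F') (at p within M)" "v \<in> tangent_space M p"
  shows "frechet_derivative F (at p within M) v = F' v"
proof -
  have F: "(F has_derivative frechet_derivative F (at p within M)) (at p within M)"
    using assms(1) by (auto simp: frechet_derivative_works[symmetric] differentiable_def)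
  obtain \<gamma> where \<gamma>: "range \<gamma> \<subseteq> M" "\<gamma> 0 = p" "(\<gamma> has_vector_derivative v) (at (0::real))"
    using assms(2) by (auto simp: tangent_space_def)
  show ?thesis
    using has_derivative_along_curve[OF F \<gamma>] has_derivative_along_curve[OF assms(1) \<gamma>]
    by (rule vector_derivative_unique_at)
qed

text \<open>Such a retraction of a neighbourhood in the ambient space into \<open>M\<close> is obtained from a slice
  chart by projecting onto the slice.\<close>

definition local_retraction ::
    "nat \<Rightarrow> 'a::euclidean_space set \<Rightarrow> 'a set \<Rightarrow> ('a \<Rightarrow> 'a) \<Rightarrow> ('a \<Rightarrow> 'a \<Rightarrow> 'a) \<Rightarrow> bool" where
  "local_retraction m M W r r' \<longleftrightarrow> open W \<and> (\<forall>k. Ck_within k r W) \<and>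
     (\<forall>k v. Ck_within k (\<lambda>x. r' x v) W) \<and> (\<forall>x\<in>W. (r has_derivative r' x) (at x)) \<and>
     r ` W \<subseteq> M \<and> (\<forall>q\<in>M \<inter> W. r q = q) \<and> (\<forall>q\<in>M \<inter> W. dim (range (r' q)) = m)"

lemma local_retraction_exists:
  assumes "smooth_submanifold m M" "p \<in> M"
  obtains W r r' where "p \<in> W" "local_retraction m M W r r'"
proof -
  obtain U and V :: "'a set" and E \<Phi> \<Psi> where *: "open U" "p \<in> U" "open V" "subspace E" "dim E = m"
      "homeomorphism U V \<Phi> \<Psi>" "smooth_on \<Phi> U" "smooth_on \<Psi> V" "\<Phi> ` (M \<inter> U) = E \<inter> V"
    using assms unfolding smooth_submanifold_def by metis
  let ?P = "orth_proj E"
  have linP: "linear ?P" and blP: "bounded_linear ?P"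
    using linear_orth_proj[OF *(4)] by (auto simp: linear_conv_bounded_linear)
  \<comment> \<open>The part of the chart domain where the projected point stays in V, so that
    \<open>\<Psi>\<close> may be applied to it.\<close>
  define W where "W = U \<inter> (\<lambda>x. ?P (\<Phi> x)) -` V"
  define r where "r = (\<lambda>x. \<Psi> (?P (\<Phi> x)))"
  define \<Phi>' where "\<Phi>' = (\<lambda>x. frechet_derivative \<Phi> (at x))"
  define \<Psi>' where "\<Psi>' = (\<lambda>x. frechet_derivative \<Psi> (at x))"
  define r' where "r' = (\<lambda>x v. \<Psi>' (?P (\<Phi> x)) (?P (\<Phi>' x v)))"
  have d\<Phi>: "(\<Phi> has_derivative \<Phi>' x) (at x)" if "x \<in> U" for x
    using smooth_on_frechet_derivative(1)[OF *(7) that] by (simp add: \<Phi>'_def)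
  have d\<Psi>: "(\<Psi> has_derivative \<Psi>' x) (at x)" if "x \<in> V" for x
    using smooth_on_frechet_derivative(1)[OF *(8) that] by (simp add: \<Psi>'_def)
  have cW: "Ck_within k (\<lambda>x. ?P (\<Phi> x)) W" for k
    by (rule Ck_within_bounded_linear[OF blP Ck_within_subset[OF smooth_on_imp_Ck_within[OF *(7)]]])
      (auto simp: W_def)
  have "continuous_on U (\<lambda>x. ?P (\<Phi> x))"
    using *(6) by (intro bounded_linear.continuous_on[OF blP]) (auto simp: homeomorphism_def)
  then have "open W" using *(1,3) unfolding W_def by (simp add: continuous_open_preimage)
  have slice: "\<Phi> q \<in> V" "?P (\<Phi> q) = \<Phi> q" "\<Psi> (\<Phi> q) = q" "q \<in> W" if "q \<in> M" "q \<in> U" for q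
  proof -
    have "\<Phi> q \<in> E \<inter> V" using that *(9) by blast
    then show "\<Phi> q \<in> V" "?P (\<Phi> q) = \<Phi> q" using orth_proj_id[OF *(4)] by auto
    then show "q \<in> W" using that by (auto simp: W_def)
    show "\<Psi> (\<Phi> q) = q" using that *(6) by (simp add: homeomorphism_def)
  qed
  have "r x \<in> M" if "x \<in> W" for x
  proof -
    have "?P (\<Phi> x) \<in> E \<inter> V" using that orth_proj_in[OF *(4)] by (auto simp: W_def)
    then obtain q where "q \<in> M" "q \<in> U" "?P (\<Phi> x) = \<Phi> q" using *(9) by blast
    then show ?thesis using slice by (simp add: r_def)
  qed
  moreover have "r q = q" if "q \<in> M \<inter> W" for q
    using that slice by (auto simp: r_def W_def)
  moreover have "(r has_derivative r' x) (at x)" if "x \<in> W" for x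
  proof -
    have "((\<lambda>x. ?P (\<Phi> x)) has_derivative (\<lambda>v. ?P (\<Phi>' x v))) (at x)"
      using that by (intro bounded_linear.has_derivative[OF blP] d\<Phi>) (auto simp: W_def)
    from has_derivative_compose[OF this d\<Psi>] show ?thesis
      using that by (auto simp: W_def r_def r'_def)
  qed
  moreover have "Ck_within k r W" for k
    unfolding r_def
    by (rule Ck_within_compose[OF smooth_on_imp_Ck_within[OF *(8)] cW]) (auto simp: W_def)
  moreover have "Ck_within k (\<lambda>x. r' x v) W" for k v
    unfolding r'_def
  proof (rule Ck_within_linear_family[where F = "\<lambda>x. \<Psi>' (?P (\<Phi> x))"])
    show "linear (\<Psi>' (?P (\<Phi> x)))" if "x \<in> W" for x
      using that by (intro has_derivative_linear[OF d\<Psi>]) (auto simp: W_def)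
    show "Ck_within k (\<lambda>x. \<Psi>' (?P (\<Phi> x)) b) W" for b
      unfolding \<Psi>'_def
      by (rule Ck_within_compose[OF smooth_on_imp_Ck_within[OF smooth_on_frechet_derivative(2)[OF *(8)]] cW])
        (auto simp: W_def)
    show "Ck_within k (\<lambda>x. ?P (\<Phi>' x v)) W"
      unfolding \<Phi>'_def
      by (rule Ck_within_bounded_linear[OF blP Ck_within_subset[OF
            smooth_on_imp_Ck_within[OF smooth_on_frechet_derivative(2)[OF *(7)]]]])
        (auto simp: W_def)
  qed
  \<comment> \<open>At a point of M the derivatives of \<open>\<Phi>\<close> and
    \<open>\<Psi>\<close> are inverse to each other, so the range is the image of E under an
    injective map.\<close>
  moreover have "dim (range (r' q)) = m" if "q \<in> M \<inter> W" for q
  proof -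
    have q: "q \<in> U" "\<Phi> q \<in> V" "?P (\<Phi> q) = \<Phi> q" "\<Psi> (\<Phi> q) = q"
      using that slice by (auto simp: W_def)
    have "(\<Psi> \<circ> \<Phi> has_derivative \<Psi>' (\<Phi> q) \<circ> \<Phi>' q) (at q)"
      using q d\<Phi> d\<Psi> by (intro diff_chain_at)
    moreover have "(\<Phi> \<circ> \<Psi> has_derivative \<Phi>' q \<circ> \<Psi>' (\<Phi> q)) (at (\<Phi> q))"
      using q d\<Phi> d\<Psi> by (intro diff_chain_at) auto
    moreover have "(\<Psi> \<circ> \<Phi> has_derivative id) (at q)"
      by (rule has_derivative_transform_within_open[OF has_derivative_id \<open>open U\<close> \<open>q \<in> U\<close>])
        (use *(6) in \<open>auto simp: homeomorphism_def\<close>)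
    moreover have "(\<Phi> \<circ> \<Psi> has_derivative id) (at (\<Phi> q))"
      by (rule has_derivative_transform_within_open[OF has_derivative_id \<open>open V\<close> \<open>\<Phi> q \<in> V\<close>])
        (use *(6) in \<open>auto simp: homeomorphism_def\<close>)
    ultimately have inv: "\<Psi>' (\<Phi> q) \<circ> \<Phi>' q = id" "\<Phi>' q \<circ> \<Psi>' (\<Phi> q) = id"
      by (auto intro: has_derivative_unique)
    have "range (\<lambda>v. ?P (\<Phi>' q v)) = E"
    proof -
      have "range (\<Phi>' q) = UNIV" using inv(2) by (metis comp_def id_apply surjI)
      then have "range (\<lambda>v. ?P (\<Phi>' q v)) = range ?P" by (metis image_image)
      then show ?thesis
        using orth_proj_in[OF *(4)] orth_proj_id[OF *(4)] by (auto simp: image_iff) metis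
    qed
    then have "range (r' q) = \<Psi>' (\<Phi> q) ` E"
      unfolding r'_def q(3) by (metis image_image)
    moreover have "inj (\<Psi>' (\<Phi> q))" using inv(2) by (metis comp_def id_apply injI)
    moreover have "linear (\<Psi>' (\<Phi> q))" using has_derivative_linear[OF d\<Psi>] q by blast
    ultimately show ?thesis
      using dim_image_eq[of "\<Psi>' (\<Phi> q)" E] \<open>dim E = m\<close> by (metis inj_on_subset subset_UNIV)
  qed
  ultimately have "local_retraction m M W r r'"
    unfolding local_retraction_def using \<open>open W\<close> by blast
  then show thesis using that slice(4) *(2) assms(2) by blast
qed

context
  fixes m M W r r'
  assumes retr: "local_retraction m M W r r'"
begin

lemma local_retractionD:
  shows "open W" "Ck_within k r W" "Ck_within k (\<lambda>x. r' x v) W"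
    "\<And>x. x \<in> W \<Longrightarrow> (r has_derivative r' x) (at x)" "r ` W \<subseteq> M" "\<And>q. q \<in> M \<Longrightarrow> q \<in> W \<Longrightarrow> r q = q"
    "\<And>q. q \<in> M \<Longrightarrow> q \<in> W \<Longrightarrow> dim (range (r' q)) = m" "\<And>x. x \<in> W \<Longrightarrow> linear (r' x)"
  using retr by (auto simp: local_retraction_def intro: has_derivative_linear)

lemma local_retraction_line:
  assumes "x \<in> W"
  shows "((\<lambda>t::real. r (x + t *\<^sub>R v)) has_vector_derivative r' x v) (at 0)"
proof -
  have "((\<lambda>t::real. x + t *\<^sub>R v) has_vector_derivative v) (at 0)"
    by (auto intro!: derivative_eq_intros simp: has_vector_derivative_def)
  moreover have "(r has_derivative r' x) (at (x + 0 *\<^sub>R v) within (\<lambda>t. x + t *\<^sub>R v) ` UNIV)"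
    using local_retractionD(4)[OF assms] by (auto intro: has_derivative_at_withinI)
  ultimately show ?thesis
    using vector_derivative_diff_chain_within[of "\<lambda>t. x + t *\<^sub>R v" v 0 UNIV] by (simp add: o_def)
qed

lemma local_retraction_tangent:
  assumes "x \<in> W"
  shows "r' x v \<in> tangent_space M (r x)"
proof -
  have "open ((\<lambda>t::real. x + t *\<^sub>R v) -` W)"
    by (intro open_vimage local_retractionD(1) continuous_intros)
  moreover have "0 \<in> (\<lambda>t::real. x + t *\<^sub>R v) -` W" using assms by simp
  ultimately obtain e where "e > 0" "ball 0 e \<subseteq> (\<lambda>t::real. x + t *\<^sub>R v) -` W"
    unfolding open_contains_ball by blast
  then have e: "e > 0" "\<And>t. \<bar>t\<bar> < e \<Longrightarrow> x + t *\<^sub>R v \<in> W"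
    by auto
  show ?thesis
    using e local_retractionD(5) local_retraction_line[OF assms, of v]
    by (intro tangent_spaceI[of e "\<lambda>t. r (x + t *\<^sub>R v)"]) auto
qed

text \<open>A curve in M through q is unchanged by r for small times; differentiate r o \<gamma> =
  \<gamma> at 0.\<close>

lemma local_retraction_fixes_tangent:
  assumes "q \<in> M" "q \<in> W" "v \<in> tangent_space M q"
  shows "r' q v = v"
proof -
  obtain \<gamma> where \<gamma>: "range \<gamma> \<subseteq> M" "\<gamma> 0 = q" "(\<gamma> has_vector_derivative v) (at (0::real))"
    using assms(3) by (auto simp: tangent_space_def)
  have "((\<lambda>t. r (\<gamma> t)) has_vector_derivative r' q v) (at 0)"
    using has_derivative_along_curve[OF has_derivative_at_withinI[OF local_retractionD(4)[OF assms(2)]] \<gamma>] .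
  moreover have "((\<lambda>t. r (\<gamma> t)) has_vector_derivative v) (at 0)"
  proof -
    have "\<gamma> \<midarrow>0\<rightarrow> q"
      using has_vector_derivative_continuous[OF \<gamma>(3)] \<gamma>(2) by (simp add: continuous_at isCont_def)
    then have "\<forall>\<^sub>F t in at 0. \<gamma> t \<in> W"
      using assms(2) local_retractionD(1) by (simp add: tendsto_def)
    then have ev: "\<forall>\<^sub>F t in at 0. \<gamma> t = r (\<gamma> t)"
      by eventually_elim (use local_retractionD(6) \<gamma>(1) in force)
    have eq: "\<gamma> 0 = r (\<gamma> 0)" using \<gamma>(2) assms local_retractionD(6) by simp
    show ?thesis
      unfolding has_vector_derivative_def
      by (rule has_derivative_transform_eventually[OF _ ev eq UNIV_I])
        (rule \<gamma>(3)[unfolded has_vector_derivative_def])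
  qed
  ultimately show ?thesis by (rule vector_derivative_unique_at)
qed

text \<open>This is what makes the set of velocities of curves a linear space of dimension m, which
  its definition does not show. One inclusion retracts straight lines into M, the other is
  \<open>local_retraction_fixes_tangent\<close>.\<close>

lemma tangent_space_eq_range:
  assumes "q \<in> M" "q \<in> W"
  shows "tangent_space M q = range (r' q)"
  using local_retraction_tangent[OF assms(2)] local_retraction_fixes_tangent[OF assms]
    local_retractionD(6)[OF assms] by (auto simp: image_iff) metis

end

lemma
  assumes "smooth_submanifold m M" "q \<in> M"
  shows subspace_tangent_space: "subspace (tangent_space M q)"
    and dim_tangent_space: "dim (tangent_space M q) = m"
proof -
  obtain W r r' where W: "q \<in> W" "local_retraction m M W r r'"
    using local_retraction_exists[OF assms] .
  note * = tangent_space_eq_range[OF W(2) assms(2) W(1)]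
  show "subspace (tangent_space M q)"
    unfolding * using local_retractionD(8)[OF W(2) W(1)] by (simp add: linear_subspace_image)
  show "dim (tangent_space M q) = m"
    unfolding * by (rule local_retractionD(7)[OF W(2) assms(2) W(1)])
qed

section \<open>Second derivatives\<close>

lemma has_real_derivative_along_line:
  fixes F :: "'a::real_normed_vector \<Rightarrow> real"
  assumes "(F has_derivative F') (at (q + s *\<^sub>R Z))"
  shows "((\<lambda>s. F (q + s *\<^sub>R Z)) has_real_derivative F' Z) (at s)"
proof -
  have "((\<lambda>s. q + s *\<^sub>R Z) has_vector_derivative Z) (at s)"
    by (auto intro!: derivative_eq_intros simp: has_vector_derivative_def)
  from vector_derivative_diff_chain_within[OF this has_derivative_at_withinI[OF assms]]
  show ?thesis by (simp add: o_def has_real_derivative_iff_has_vector_derivative)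
qed

text \<open>The mean value theorem is used twice: along X for the increment of G in the direction Y,
  then along Y for the resulting difference of derivatives.\<close>

lemma second_difference_mean_value:
  fixes G :: "'a::real_normed_vector \<Rightarrow> real"
  assumes G: "\<And>x. x \<in> W \<Longrightarrow> (G has_derivative G' x) (at x)"
    and G2: "\<And>x. x \<in> W \<Longrightarrow> ((\<lambda>x. G' x X) has_derivative H x) (at x)"
    and "h > 0" and sq: "\<And>s t. 0 \<le> s \<Longrightarrow> s \<le> h \<Longrightarrow> 0 \<le> t \<Longrightarrow> t \<le> h \<Longrightarrow> p + s *\<^sub>R X + t *\<^sub>R Y \<in> W"
  obtains s t where "0 < s" "s < h" "0 < t" "t < h"
    "G (p + h *\<^sub>R X + h *\<^sub>R Y) - G (p + h *\<^sub>R X) - G (p + h *\<^sub>R Y) + G p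
      = h\<^sup>2 * H (p + s *\<^sub>R X + t *\<^sub>R Y) Y"
proof -
  define \<phi> where "\<phi> = (\<lambda>s. G (p + s *\<^sub>R X + h *\<^sub>R Y) - G (p + s *\<^sub>R X))"
  have "\<exists>s>0. s < h \<and> \<phi> h - \<phi> 0 = (h - 0) * (G' (p + s *\<^sub>R X + h *\<^sub>R Y) X - G' (p + s *\<^sub>R X) X)"
  proof (rule MVT2[OF \<open>h > 0\<close>])
    fix s assume s: "0 \<le> s" "s \<le> h"
    have "((\<lambda>s. G ((p + h *\<^sub>R Y) + s *\<^sub>R X)) has_real_derivative G' (p + s *\<^sub>R X + h *\<^sub>R Y) X) (at s)"
      using sq[OF s, of h] \<open>h > 0\<close> by (intro has_real_derivative_along_line) (simp add: add.assoc add.commute[of "h *\<^sub>R Y"] G)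
    moreover have "((\<lambda>s. G (p + s *\<^sub>R X)) has_real_derivative G' (p + s *\<^sub>R X) X) (at s)"
      using sq[OF s, of 0] \<open>h > 0\<close> by (intro has_real_derivative_along_line) (simp add: G)
    ultimately show "(\<phi> has_real_derivative G' (p + s *\<^sub>R X + h *\<^sub>R Y) X - G' (p + s *\<^sub>R X) X) (at s)"
      unfolding \<phi>_def by (intro DERIV_diff) (simp_all add: ac_simps)
  qed
  then obtain s where s: "0 < s" "s < h"
    "\<phi> h - \<phi> 0 = h * (G' (p + s *\<^sub>R X + h *\<^sub>R Y) X - G' (p + s *\<^sub>R X) X)" by auto
  have "\<exists>t>0. t < h \<and> G' (p + s *\<^sub>R X + h *\<^sub>R Y) X - G' (p + s *\<^sub>R X + 0 *\<^sub>R Y) X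
      = (h - 0) * H (p + s *\<^sub>R X + t *\<^sub>R Y) Y"
    using s sq by (intro MVT2[OF \<open>h > 0\<close>] has_real_derivative_along_line[where F = "\<lambda>x. G' x X"] G2) auto
  then show thesis
    using s that by (auto simp: \<phi>_def power2_eq_square algebra_simps)
qed

text \<open>Schwarz's theorem. The second difference over a small parallelogram is symmetric in X
  and Y, and by the previous lemma it equals h^2 times either mixed derivative at some nearby
  point.\<close>

lemma second_derivative_symmetric:
  fixes G :: "'a::euclidean_space \<Rightarrow> real"
  assumes W: "open W" "p \<in> W" and G: "\<And>x. x \<in> W \<Longrightarrow> (G has_derivative G' x) (at x)"
    and GX: "\<And>x. x \<in> W \<Longrightarrow> ((\<lambda>x. G' x X) has_derivative HX x) (at x)"
    and GY: "\<And>x. x \<in> W \<Longrightarrow> ((\<lambda>x. G' x Y) has_derivative HY x) (at x)"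
    and cont: "continuous_on W (\<lambda>x. HX x Y)" "continuous_on W (\<lambda>x. HY x X)"
  shows "HX p Y = HY p X"
proof (rule ccontr)
  assume "HX p Y \<noteq> HY p X"
  \<comment> \<open>Half the supposed discrepancy: two approximations with error below it cannot
    share a common value.\<close>
  define \<epsilon> where "\<epsilon> = \<bar>HX p Y - HY p X\<bar> / 2"
  have "\<epsilon> > 0" using \<open>HX p Y \<noteq> HY p X\<close> by (simp add: \<epsilon>_def)
  have "isCont (\<lambda>x. HX x Y) p" "isCont (\<lambda>x. HY x X) p"
    using cont W by (auto simp: continuous_on_eq_continuous_at)
  then obtain d1 d2 where d12: "d1 > 0" "\<And>x. dist x p < d1 \<Longrightarrow> \<bar>HX x Y - HX p Y\<bar> < \<epsilon>"
      "d2 > 0" "\<And>x. dist x p < d2 \<Longrightarrow> \<bar>HY x X - HY p X\<bar> < \<epsilon>"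
    using \<open>\<epsilon> > 0\<close> unfolding continuous_at_eps_delta by (metis dist_real_def)
  obtain d3 where d3: "d3 > 0" "\<And>x. dist x p < d3 \<Longrightarrow> x \<in> W"
    using W unfolding open_dist by metis
  define d where "d = min d3 (min d1 d2)"
  have "d > 0" using d12 d3 by (simp add: d_def)
  \<comment> \<open>Keeps the parallelogram with sides h X and h Y within distance d/2 of p; the
    summand 1 covers X = Y = 0.\<close>
  define h where "h = d / (2 * (norm X + norm Y + 1))"
  have nn: "0 < norm X + norm Y + 1" by (simp add: add_nonneg_pos)
  have "h > 0" using \<open>d > 0\<close> nn by (simp add: h_def)
  have small: "dist (p + s *\<^sub>R X + t *\<^sub>R Y) p < d" "dist (p + s *\<^sub>R Y + t *\<^sub>R X) p < d"
    if "0 \<le> s" "s \<le> h" "0 \<le> t" "t \<le> h" for s t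
  proof -
    have *: "a * norm X + b * norm Y < d" if "0 \<le> a" "a \<le> h" "0 \<le> b" "b \<le> h" for a b
    proof -
      have "a * norm X + b * norm Y \<le> h * norm X + h * norm Y"
        using that by (intro add_mono mult_right_mono) auto
      also have "\<dots> \<le> h * (norm X + norm Y + 1)" using \<open>h > 0\<close> by (simp add: algebra_simps)
      also have "\<dots> = d / 2" using nn by (simp add: h_def field_simps)
      finally show ?thesis using \<open>d > 0\<close> by simp
    qed
    have "dist (p + s *\<^sub>R X + t *\<^sub>R Y) p \<le> s * norm X + t * norm Y"
      using norm_triangle_ineq[of "s *\<^sub>R X" "t *\<^sub>R Y"] that by (simp add: dist_norm add.assoc)
    then show "dist (p + s *\<^sub>R X + t *\<^sub>R Y) p < d" using *[of s t] that by simp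
    have "dist (p + s *\<^sub>R Y + t *\<^sub>R X) p \<le> t * norm X + s * norm Y"
      using norm_triangle_ineq[of "s *\<^sub>R Y" "t *\<^sub>R X"] that by (simp add: dist_norm add.assoc)
    then show "dist (p + s *\<^sub>R Y + t *\<^sub>R X) p < d" using *[of t s] that by simp
  qed
  obtain s t where st: "0 < s" "s < h" "0 < t" "t < h"
    "G (p + h *\<^sub>R X + h *\<^sub>R Y) - G (p + h *\<^sub>R X) - G (p + h *\<^sub>R Y) + G p
      = h\<^sup>2 * HX (p + s *\<^sub>R X + t *\<^sub>R Y) Y"
    by (rule second_difference_mean_value[OF G GX \<open>h > 0\<close>]) (use small d3 in \<open>auto simp: d_def\<close>)
  obtain s' t' where st': "0 < s'" "s' < h" "0 < t'" "t' < h"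
    "G (p + h *\<^sub>R Y + h *\<^sub>R X) - G (p + h *\<^sub>R Y) - G (p + h *\<^sub>R X) + G p
      = h\<^sup>2 * HY (p + s' *\<^sub>R Y + t' *\<^sub>R X) X"
    by (rule second_difference_mean_value[OF G GY \<open>h > 0\<close>]) (use small d3 in \<open>auto simp: d_def\<close>)
  have "h\<^sup>2 * HX (p + s *\<^sub>R X + t *\<^sub>R Y) Y = h\<^sup>2 * HY (p + s' *\<^sub>R Y + t' *\<^sub>R X) X"
    using st(5) st'(5) by (simp add: algebra_simps)
  then have "HX (p + s *\<^sub>R X + t *\<^sub>R Y) Y = HY (p + s' *\<^sub>R Y + t' *\<^sub>R X) X"
    using \<open>h > 0\<close> by simp
  moreover have "\<bar>HX (p + s *\<^sub>R X + t *\<^sub>R Y) Y - HX p Y\<bar> < \<epsilon>"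
    using small(1)[of s t] st by (intro d12) (auto simp: d_def)
  moreover have "\<bar>HY (p + s' *\<^sub>R Y + t' *\<^sub>R X) X - HY p X\<bar> < \<epsilon>"
    using small(2)[of s' t'] st' by (intro d12) (auto simp: d_def)
  ultimately show False unfolding \<epsilon>_def by (auto simp: abs_if split: if_splits)
qed

text \<open>The first derivative vanishes at p. If the second were positive along X, the first would
  be positive just after p on the line in direction X, and the mean value theorem would give a value
  above the maximum.\<close>

lemma second_derivative_test:
  fixes G :: "'a::euclidean_space \<Rightarrow> real"
  assumes W: "open W" "p \<in> W" and G: "\<And>x. x \<in> W \<Longrightarrow> (G has_derivative G' x) (at x)"
    and H: "((\<lambda>x. G' x X) has_derivative H) (at p)" and max: "\<And>x. x \<in> W \<Longrightarrow> G x \<le> G p"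
  shows "H X \<le> 0"
proof (rule ccontr)
  assume "\<not> H X \<le> 0"
  have "G' p = (\<lambda>v. 0)"
    using differential_zero_maxmin[OF W(2,1) G[OF W(2)]] max by blast
  have "((\<lambda>s. G' (p + s *\<^sub>R X) X) has_real_derivative H X) (at 0)"
    using has_real_derivative_along_line[of "\<lambda>x. G' x X" H p 0 X] H by simp
  from DERIV_pos_inc_right[OF this] obtain d where
    d: "d > 0" "\<And>s. 0 < s \<Longrightarrow> s < d \<Longrightarrow> 0 < G' (p + s *\<^sub>R X) X"
    using \<open>\<not> H X \<le> 0\<close> \<open>G' p = (\<lambda>v. 0)\<close> by auto
  have "open ((\<lambda>s::real. p + s *\<^sub>R X) -` W)"
    by (intro open_vimage W continuous_intros)
  moreover have "0 \<in> (\<lambda>s::real. p + s *\<^sub>R X) -` W" using W by simp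
  ultimately obtain e where "e > 0" "ball 0 e \<subseteq> (\<lambda>s::real. p + s *\<^sub>R X) -` W"
    unfolding open_contains_ball by blast
  then have e: "e > 0" "\<And>s. \<bar>s\<bar> < e \<Longrightarrow> p + s *\<^sub>R X \<in> W" by auto
  define h where "h = min d e / 2"
  have h: "0 < h" "h < d" "h < e" using d e by (auto simp: h_def)
  have "\<exists>s>0. s < h \<and> G (p + h *\<^sub>R X) - G (p + 0 *\<^sub>R X) = (h - 0) * G' (p + s *\<^sub>R X) X"
    using h e by (intro MVT2 has_real_derivative_along_line G) auto
  then obtain s where "0 < s" "s < h" "G (p + h *\<^sub>R X) - G p = h * G' (p + s *\<^sub>R X) X" by auto
  moreover from this have "0 < G' (p + s *\<^sub>R X) X" using d h by simp
  ultimately have "G (p + h *\<^sub>R X) > G p" using h by (metis diff_gt_0_iff_gt mult_pos_pos)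
  then show False using max[OF e(2)[of h]] h by simp
qed

section \<open>Smoothness of the tangential projection\<close>

text \<open>A product rule in which the factor Q need only be continuous, because the other factor
  \<open>g y - g x\<close> vanishes at x. It allows the projections to be differentiated when only
  their continuity is known.\<close>

lemma has_derivative_contraction_family:
  fixes Q :: "'a::real_normed_vector \<Rightarrow> 'b::euclidean_space \<Rightarrow> 'c::real_normed_vector"
  assumes x: "x \<in> A" and lin: "\<And>y. y \<in> A \<Longrightarrow> linear (Q y)"
    and le: "\<And>y z. y \<in> A \<Longrightarrow> norm (Q y z) \<le> norm z"
    and lim: "\<And>z. ((\<lambda>y. Q y z) \<longlongrightarrow> Q x z) (at x within A)"
    and g: "(g has_derivative g') (at x within A)"
  shows "((\<lambda>y. Q y (g y - g x)) has_derivative (\<lambda>h. Q x (g' h))) (at x within A)"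
proof -
  have g': "bounded_linear g'" using g by (rule has_derivative_bounded_linear)
  then obtain K where K: "\<And>h. norm (g' h) \<le> norm h * K"
    using bounded_linear.bounded by blast
  have Q: "bounded_linear (Q y)" if "y \<in> A" for y
    using lin[OF that] by (simp add: linear_conv_bounded_linear)
  \<comment> \<open>The first term bounds the linearisation error of g, which Q y does not enlarge;
    the second bounds the change from Q x to Q y on \<open>g' (y - x)\<close>, expanded in the
    standard basis.\<close>
  define H where "H = (\<lambda>y. norm (g y - g x - g' (y - x)) / norm (y - x)
    + K * (\<Sum>b\<in>Basis. norm (Q y b - Q x b)))"
  show ?thesis
  proof (rule has_derivativeI_sandwich[of 1])
    show "bounded_linear (\<lambda>h. Q x (g' h))" using bounded_linear_compose[OF Q[OF x] g'] .
    have "((\<lambda>y. norm (g y - g x - g' (y - x)) / norm (y - x)) \<longlongrightarrow> 0) (at x within A)"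
      using g by (simp add: has_derivative_iff_norm)
    moreover have "((\<lambda>y. K * (\<Sum>b\<in>Basis. norm (Q y b - Q x b))) \<longlongrightarrow> K * (\<Sum>b\<in>(Basis::'b set). norm (Q x b - Q x b))) (at x within A)"
      by (intro tendsto_intros lim)
    ultimately show "(H \<longlongrightarrow> 0) (at x within A)"
      unfolding H_def by (auto intro: tendsto_add_zero)
    fix y assume y: "y \<in> A" "y \<noteq> x" "dist y x < 1"
    have "norm (Q y (g' (y - x)) - Q x (g' (y - x)))
        = norm (\<Sum>b\<in>Basis. (g' (y - x) \<bullet> b) *\<^sub>R (Q y b - Q x b))"
      using linear_euclidean_sum[OF lin[OF y(1)], of "g' (y - x)"]
        linear_euclidean_sum[OF lin[OF x], of "g' (y - x)"]
      by (simp add: sum_subtractf scaleR_diff_right)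
    also have "\<dots> \<le> (\<Sum>b\<in>Basis. (norm (y - x) * K) * norm (Q y b - Q x b))"
    proof (intro sum_norm_le)
      fix b :: 'b assume "b \<in> Basis"
      then have "\<bar>g' (y - x) \<bullet> b\<bar> \<le> norm (y - x) * K"
        using Basis_le_norm K by (meson order_trans)
      then show "norm ((g' (y - x) \<bullet> b) *\<^sub>R (Q y b - Q x b)) \<le> (norm (y - x) * K) * norm (Q y b - Q x b)"
        by (simp add: mult_right_mono)
    qed
    finally have 1: "norm (Q y (g' (y - x)) - Q x (g' (y - x)))
        \<le> norm (y - x) * (K * (\<Sum>b\<in>Basis. norm (Q y b - Q x b)))"
      by (simp add: sum_distrib_left mult.assoc)
    have "Q y (g y - g x) - Q y (g x - g x) - Q x (g' (y - x))
        = Q y (g y - g x - g' (y - x)) + (Q y (g' (y - x)) - Q x (g' (y - x)))"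
      using lin[OF y(1)] by (simp add: linear_diff linear_0)
    then have "norm (Q y (g y - g x) - Q y (g x - g x) - Q x (g' (y - x)))
        \<le> norm (g y - g x - g' (y - x)) + norm (y - x) * (K * (\<Sum>b\<in>Basis. norm (Q y b - Q x b)))"
      by (simp only:) (rule norm_triangle_mono[OF le[OF y(1)] 1])
    moreover have "Q y (g x - g x) = 0" "Q x (g x - g x) = 0" using lin y(1) x by (auto simp: linear_0)
    ultimately show "norm (Q y (g y - g x) - Q x (g x - g x) - Q x (g' (y - x))) / norm (y - x) \<le> H y"
      using y(2) by (simp add: H_def field_simps)
  qed simp
qed

text \<open>If \<open>L\<close> and \<open>P\<close> are the given and the orthogonal projection onto the same space, then
  \<open>P y - P x = P y \<circ> (L y - L x)\<^sup>T \<circ> (I - P x) + (I - P y) \<circ> (L y - L x) \<circ> P x\<close>. Hence the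
  derivative of \<open>P\<close> is \<open>P \<circ> L'\<^sup>T \<circ> (I - P) + (I - P) \<circ> L' \<circ> P\<close>, which gives the regularity of
  \<open>P\<close> by induction.\<close>

lemma Ck_within_orth_proj:
  fixes L :: "'a::euclidean_space \<Rightarrow> 'a \<Rightarrow> 'a"
  assumes sub: "\<And>q. q \<in> A \<Longrightarrow> subspace (S q)" and lin: "\<And>q. q \<in> A \<Longrightarrow> linear (L q)"
    and in_S: "\<And>q v. q \<in> A \<Longrightarrow> L q v \<in> S q" and id: "\<And>q v. q \<in> A \<Longrightarrow> v \<in> S q \<Longrightarrow> L q v = v"
    and L: "\<And>k v. Ck_within k (\<lambda>q. L q v) A"
  shows "Ck_within k (\<lambda>q. orth_proj (S q) v) A"
proof -
  define P where "P q = orth_proj (S q)" for q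
  define LT where "LT = (\<lambda>q w. \<Sum>b\<in>Basis. (w \<bullet> L q b) *\<^sub>R b)"
  note linP = linear_orth_proj[OF sub, folded P_def] and inP = orth_proj_in[OF sub, folded P_def]
    and idP = orth_proj_id[OF sub, folded P_def] and adjP = orth_proj_self_adjoint[OF sub, folded P_def]
    and nP = norm_orth_proj_le[OF sub, folded P_def] and innP = orth_proj_inner[OF sub, folded P_def]
  have LT: "LT q w \<bullet> v = w \<bullet> L q v" if "q \<in> A" for q w v
    by (subst linear_euclidean_sum[OF lin[OF that], of v])
      (simp add: LT_def inner_sum_left inner_sum_right inner_commute mult.commute)
  \<comment> \<open>The adjoint form of L P = P. The next fact holds likewise because L maps into
    the subspace, so its adjoint kills the orthogonal complement.\<close>
  have P_LT: "P q (LT q w) = P q w" if "q \<in> A" for q w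
  proof (rule vector_eq_ldot[THEN iffD1, rule_format])
    fix z
    show "z \<bullet> P q (LT q w) = z \<bullet> P q w"
      using adjP[OF that, of _ z] LT[OF that] id[OF that inP[OF that]]
      by (metis inner_commute)
  qed
  have LT_normal: "LT q (v - P q v) = 0" if "q \<in> A" for q v
  proof (rule vector_eq_ldot[THEN iffD1, rule_format])
    fix z
    show "z \<bullet> LT q (v - P q v) = z \<bullet> 0"
      using innP[OF that in_S[OF that, of z], of v] LT[OF that, of "v - P q v" z]
      by (simp add: inner_commute[of z] inner_diff_left)
  qed
  \<comment> \<open>On the right, the first summand is P y (v - P x v). In the second, I - P y kills
    \<open>L y (P x v)\<close> and \<open>L x\<close> fixes \<open>P x v\<close>, which leaves P y
    (P x v) - P x v.\<close>
  have diff: "P y v - P x v = P y (LT y (v - P x v) - LT x (v - P x v))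
      + ((L y (P x v) - L x (P x v)) - P y (L y (P x v) - L x (P x v)))"
    if x: "x \<in> A" and y: "y \<in> A" for x y v
  proof -
    have "P y (LT y (v - P x v) - LT x (v - P x v)) = P y (v - P x v)"
      by (simp only: LT_normal[OF x] diff_zero P_LT[OF y])
    moreover have "P y (L y (P x v) - L x (P x v)) = L y (P x v) - P y (P x v)"
      by (simp only: linear_diff[OF linP[OF y]] id[OF x inP[OF x]] idP[OF y in_S[OF y]])
    ultimately show ?thesis
      by (simp add: linear_diff[OF linP[OF y]] id[OF x inP[OF x]])
  qed
  have key: "Ck_within k (\<lambda>q. P q v) A" for v
  proof (induction k arbitrary: v)
    case 0
    \<comment> \<open>Continuity of P follows directly from the difference formula: P y is a
      contraction and the differences of L and of its adjoint, at fixed vectors, tend to 0.\<close>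
    have "((\<lambda>y. P y v) \<longlongrightarrow> P x v) (at x within A)" if x: "x \<in> A" for x v
    proof -
      have cL: "continuous_on A (\<lambda>q. L q u)" for u using L[of 0] by simp
      then have Lx: "((\<lambda>y. L y u) \<longlongrightarrow> L x u) (at x within A)" for u
        using x by (auto simp: continuous_on_def)
      have LTx: "((\<lambda>y. LT y u) \<longlongrightarrow> LT x u) (at x within A)" for u
        unfolding LT_def by (intro tendsto_intros Lx)
      let ?a = "\<lambda>y. norm (LT y (v - P x v) - LT x (v - P x v))"
      let ?b = "\<lambda>y. norm (L y (P x v) - L x (P x v))"
      have "norm (P y v - P x v) \<le> ?a y + (?b y + ?b y)" if "y \<in> A" for y
        unfolding diff[OF x that]
        by (intro norm_triangle_mono order_trans[OF norm_triangle_ineq4 add_left_mono] nP that)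
      then have "\<forall>\<^sub>F y in at x within A. norm (P y v - P x v) \<le> ?a y + (?b y + ?b y)"
        by (simp add: eventually_at_filter)
      moreover have "((\<lambda>y. ?a y + (?b y + ?b y)) \<longlongrightarrow> norm (LT x (v - P x v) - LT x (v - P x v))
          + (norm (L x (P x v) - L x (P x v)) + norm (L x (P x v) - L x (P x v)))) (at x within A)"
        by (intro tendsto_intros Lx LTx)
      ultimately show ?thesis
        by (subst Lim_null, elim Lim_null_comparison) simp
    qed
    then show ?case by (simp add: continuous_on_def)
  next
    case (Suc k)
    have "\<exists>L'. (\<forall>x\<in>A. ((\<lambda>q. L q b) has_derivative L' x) (at x within A))
        \<and> (\<forall>h. Ck_within k (\<lambda>x. L' x h) A)" for b
      using L[of "Suc k" b] by simp
    then obtain L' where L': "\<And>b x. x \<in> A \<Longrightarrow> ((\<lambda>q. L q b) has_derivative L' b x) (at x within A)"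
        "\<And>b h. Ck_within k (\<lambda>x. L' b x h) A"
      by metis
    define Z where "Z = (\<lambda>x h. \<Sum>b\<in>Basis. (P x v \<bullet> b) *\<^sub>R L' b x h)"
    define Y where "Y = (\<lambda>x h. \<Sum>b\<in>Basis. ((v - P x v) \<bullet> L' b x h) *\<^sub>R b)"
    show ?case
    proof (rule Ck_within_SucI[where f' = "\<lambda>x h. P x (Y x h) + (Z x h - P x (Z x h))"])
      fix x assume x: "x \<in> A"
      have lim: "((\<lambda>y. P y z) \<longlongrightarrow> P x z) (at x within A)" for z
        using Ck_within_imp_continuous_on[OF Suc.IH] x by (auto simp: continuous_on_def)
      have "((\<lambda>y. \<Sum>b\<in>Basis. (P x v \<bullet> b) *\<^sub>R L y b) has_derivative Z x) (at x within A)"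
        unfolding Z_def by (intro has_derivative_sum has_derivative_scaleR_right L' x)
      then have dL: "((\<lambda>y. L y (P x v)) has_derivative Z x) (at x within A)"
        by (rule has_derivative_transform[OF x, rotated])
          (rule linear_euclidean_sum[OF lin])
      have dLT: "((\<lambda>y. LT y (v - P x v)) has_derivative Y x) (at x within A)"
        unfolding LT_def Y_def
        by (intro has_derivative_sum has_derivative_scaleR_left has_derivative_inner_right L' x)
      note c = has_derivative_contraction_family[OF x linP nP lim]
      have "((\<lambda>y. P x v + (P y (LT y (v - P x v) - LT x (v - P x v))
          + ((L y (P x v) - L x (P x v)) - P y (L y (P x v) - L x (P x v)))))
        has_derivative (\<lambda>h. 0 + (P x (Y x h) + (Z x h - 0 - P x (Z x h))))) (at x within A)"
        by (intro has_derivative_add has_derivative_diff has_derivative_const c dL dLT)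
      then have "((\<lambda>y. P x v + (P y (LT y (v - P x v) - LT x (v - P x v))
          + ((L y (P x v) - L x (P x v)) - P y (L y (P x v) - L x (P x v)))))
        has_derivative (\<lambda>h. P x (Y x h) + (Z x h - P x (Z x h)))) (at x within A)"
        by simp
      then show "((\<lambda>q. P q v) has_derivative (\<lambda>h. P x (Y x h) + (Z x h - P x (Z x h)))) (at x within A)"
      proof (rule has_derivative_transform[OF x, rotated])
        show "P y v = P x v + (P y (LT y (v - P x v) - LT x (v - P x v))
          + ((L y (P x v) - L x (P x v)) - P y (L y (P x v) - L x (P x v))))" if "y \<in> A" for y
          unfolding diff[OF x that, of v, symmetric] by simp
      qed
    next
      fix h
      have "Ck_within k (\<lambda>x. Z x h) A" "Ck_within k (\<lambda>x. Y x h) A"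
        unfolding Z_def Y_def
        by (intro Ck_within_sum Ck_within_scaleR Ck_within_inner Ck_within_diff Suc.IH L'
            Ck_within_const)+
      moreover have "Ck_within k (\<lambda>x. P x (V x)) A" if "Ck_within k V A" for V
        by (rule Ck_within_linear_family[OF linP Suc.IH that])
      ultimately show "Ck_within k (\<lambda>x. P x (Y x h) + (Z x h - P x (Z x h))) A"
        by (intro Ck_within_add Ck_within_diff) blast+
    qed
  qed
  then show ?thesis by (simp add: P_def)
qed

section \<open>Calculus on a submanifold\<close>

locale submanifold =
  fixes m :: nat and M :: "'a::euclidean_space set"
  assumes smooth: "smooth_submanifold m M"
begin

abbreviation T :: "'a \<Rightarrow> 'a set" where
  "T q \<equiv> tangent_space M q"

definition P :: "'a \<Rightarrow> 'a \<Rightarrow> 'a" where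
  "P q = orth_proj (T q)"

definition D :: "('a \<Rightarrow> 'b::real_normed_vector) \<Rightarrow> 'a \<Rightarrow> 'a \<Rightarrow> 'b" where
  "D F q = frechet_derivative F (at q within M)"

lemma subspace_T: "q \<in> M \<Longrightarrow> subspace (T q)"
  and dim_T: "q \<in> M \<Longrightarrow> dim (T q) = m"
  using subspace_tangent_space dim_tangent_space smooth by blast+

lemmas linear_P = linear_orth_proj[OF subspace_T, folded P_def]
  and P_in_T = orth_proj_in[OF subspace_T, folded P_def]
  and P_id = orth_proj_id[OF subspace_T, folded P_def]
  and P_eq_0 = orth_proj_eq_0[OF subspace_T, folded P_def]
  and P_self_adjoint = orth_proj_self_adjoint[OF subspace_T, folded P_def]
  and P_inner = orth_proj_inner[OF subspace_T, folded P_def]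

lemma P_P [simp]: "q \<in> M \<Longrightarrow> P q (P q v) = P q v"
  by (simp add: P_id P_in_T)

lemma D_eq: "(F has_derivative F') (at q within M) \<Longrightarrow> v \<in> T q \<Longrightarrow> D F q v = F' v"
  unfolding D_def by (rule frechet_derivative_within_eq)

lemma has_derivative_D: "F differentiable (at q within M) \<Longrightarrow> (F has_derivative D F q) (at q within M)"
  unfolding D_def by (simp add: frechet_derivative_works)

lemma at_within_Int_nhd: "open W \<Longrightarrow> q \<in> W \<Longrightarrow> at q within (M \<inter> W) = at q within M"
  by (rule at_within_nhd[of q W]) auto

text \<open>Exploits the non-uniqueness of derivatives within M: among the derivatives of the
  identity there is one that vanishes on normal vectors.\<close>

lemma has_derivative_ident_P:
  assumes "q \<in> M"
  shows "((\<lambda>x. x) has_derivative P q) (at q within M)"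
proof -
  obtain W r r' where W: "q \<in> W" "local_retraction m M W r r'"
    using local_retraction_exists[OF smooth assms] .
  note * = local_retractionD[OF W(2)]
  have "(r has_derivative r' q) (at q within M \<inter> W)"
    using *(4)[OF W(1)] by (rule has_derivative_at_withinI)
  then have "((\<lambda>x. x) has_derivative r' q) (at q within M \<inter> W)"
    by (rule has_derivative_transform[rotated 2]) (use *(6) assms W in auto)
  then have "((\<lambda>x. x) has_derivative r' q) (at q within M)"
    using at_within_Int_nhd *(1) W(1) by simp
  moreover have "bounded_linear (P q)"
    using linear_P[OF assms] by (simp add: linear_conv_bounded_linear)
  \<comment> \<open>In the difference the identity is given the derivative \<open>r' q\<close>,
    whose values are tangent, so that part cancels; the last summand uses the linear map
    \<open>P q\<close> itself.\<close>
  ultimately have "((\<lambda>x. (x - P q x) + P q x) has_derivative (\<lambda>v. (r' q v - P q (r' q v)) + P q v))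
      (at q within M)"
    by (intro has_derivative_add has_derivative_diff bounded_linear.has_derivative[of "P q"]
        bounded_linear_imp_has_derivative)
  moreover have "P q (r' q v) = r' q v" for v
    using tangent_space_eq_range[OF W(2) assms W(1)] assms by (simp add: P_id)
  ultimately show ?thesis by simp
qed

lemma has_derivative_P:
  assumes "(F has_derivative F') (at q within M)" "q \<in> M"
  shows "(F has_derivative (\<lambda>v. F' (P q v))) (at q within M)"
  using has_derivative_in_compose[OF has_derivative_ident_P[OF assms(2)], of F F'] assms(1) by simp

lemma Ck_within_P_local:
  assumes "p \<in> M"
  obtains W where "open W" "p \<in> W" "\<And>k v. Ck_within k (\<lambda>q. P q v) (M \<inter> W)"
proof -
  obtain W r r' where W: "p \<in> W" "local_retraction m M W r r'"
    using local_retraction_exists[OF smooth assms] .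
  note * = local_retractionD[OF W(2)]
  have "Ck_within k (\<lambda>q. orth_proj (T q) v) (M \<inter> W)" for k v
  proof (rule Ck_within_orth_proj[where L = r'])
    show "Ck_within k (\<lambda>q. r' q v) (M \<inter> W)" for k v
      using *(3) by (rule Ck_within_subset) auto
    fix q v assume q: "q \<in> M \<inter> W"
    show "subspace (T q)" using q subspace_T by blast
    show "linear (r' q)" using q *(8) by blast
    show "r' q v \<in> T q" using q tangent_space_eq_range[OF W(2)] by blast
    show "r' q v = v" if "v \<in> T q" using q that local_retraction_fixes_tangent[OF W(2)] by blast
  qed
  then show thesis using that[OF *(1) W(1)] by (simp add: P_def)
qed

lemma D_P_eq:
  assumes "(F has_derivative F') (at q within M)" "q \<in> M"
  shows "D F q (P q v) = F' (P q v)"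
  using D_eq[OF assms(1)] P_in_T[OF assms(2)] by blast

text \<open>Derivatives chosen on different patches may disagree in normal directions. Precomposing
  with P removes the disagreement, so \<open>D F q (P q v)\<close> is a single choice that works on
  all of M.\<close>

lemma Ck_within_glue:
  assumes "\<And>p. p \<in> M \<Longrightarrow> \<exists>W. open W \<and> p \<in> W \<and> Ck_within k F (M \<inter> W)"
  shows "Ck_within k F M"
  using assms
proof (induction k arbitrary: F)
  case 0
  have "continuous (at p within M) F" if p: "p \<in> M" for p
  proof -
    obtain W where W: "open W" "p \<in> W" "continuous_on (M \<inter> W) F" using 0[OF p] by auto
    then have "continuous (at p within (M \<inter> W)) F"
      using p by (simp add: continuous_on_eq_continuous_within)
    then show ?thesis using at_within_Int_nhd W by simp
  qed
  then show ?case by (simp add: continuous_on_eq_continuous_within)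
next
  case (Suc k)
  have loc: "\<exists>W f'. open W \<and> p \<in> W \<and> (\<forall>q\<in>M \<inter> W. (F has_derivative f' q) (at q within M))
      \<and> (\<forall>v. Ck_within k (\<lambda>q. f' q v) (M \<inter> W))" if p: "p \<in> M" for p
  proof -
    obtain W where W: "open W" "p \<in> W" "Ck_within (Suc k) F (M \<inter> W)" using Suc.prems[OF p] by blast
    obtain f' where f': "\<And>q. q \<in> M \<inter> W \<Longrightarrow> (F has_derivative f' q) (at q within (M \<inter> W))"
        "\<And>v. Ck_within k (\<lambda>q. f' q v) (M \<inter> W)"
      using W(3) by (rule Ck_within_SucE) blast
    then show ?thesis using W at_within_Int_nhd[OF W(1)] by auto
  qed
  show ?case
  proof (rule Ck_within_SucI[where f' = "\<lambda>q v. D F q (P q v)"])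
    fix p assume p: "p \<in> M"
    then have "F differentiable (at p within M)" using loc[OF p] by (auto simp: differentiable_def)
    then show "(F has_derivative (\<lambda>v. D F p (P p v))) (at p within M)"
      using has_derivative_P[OF has_derivative_D p] by blast
  next
    fix v
    show "Ck_within k (\<lambda>q. D F q (P q v)) M"
    proof (rule Suc.IH)
      fix p assume p: "p \<in> M"
      obtain W f' where W: "open W" "p \<in> W" "\<And>q. q \<in> M \<Longrightarrow> q \<in> W \<Longrightarrow> (F has_derivative f' q) (at q within M)"
          "\<And>v. Ck_within k (\<lambda>q. f' q v) (M \<inter> W)"
        using loc[OF p] by auto
      obtain W2 where W2: "open W2" "p \<in> W2" "\<And>k v. Ck_within k (\<lambda>q. P q v) (M \<inter> W2)"
        using Ck_within_P_local[OF p] by blast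
      have "Ck_within k (\<lambda>q. f' q (P q v)) (M \<inter> (W \<inter> W2))"
      proof (rule Ck_within_linear_family[where F = f'])
        show "linear (f' q)" if "q \<in> M \<inter> (W \<inter> W2)" for q
          using has_derivative_linear[OF W(3)] that by auto
        show "Ck_within k (\<lambda>q. f' q b) (M \<inter> (W \<inter> W2))" for b
          by (rule Ck_within_subset[OF W(4)]) auto
        show "Ck_within k (\<lambda>q. P q v) (M \<inter> (W \<inter> W2))"
          by (rule Ck_within_subset[OF W2(3)]) auto
      qed
      then have "Ck_within k (\<lambda>q. D F q (P q v)) (M \<inter> (W \<inter> W2))"
        by (rule Ck_within_eqI) (use D_P_eq[OF W(3)] in auto)
      then show "\<exists>W. open W \<and> p \<in> W \<and> Ck_within k (\<lambda>q. D F q (P q v)) (M \<inter> W)"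
        using W W2 by (intro exI[of _ "W \<inter> W2"]) auto
    qed
  qed
qed

lemma Ck_within_P: "Ck_within k (\<lambda>q. P q v) M"
  by (rule Ck_within_glue) (metis Ck_within_P_local)

lemma Ck_within_has_derivative_D:
  assumes "Ck_within (Suc k) F M" "q \<in> M"
  shows "(F has_derivative D F q) (at q within M)"
  by (rule has_derivative_D) (use assms in \<open>auto simp: differentiable_def elim!: Ck_within_SucE\<close>)

lemma linear_D: "Ck_within (Suc k) F M \<Longrightarrow> q \<in> M \<Longrightarrow> linear (D F q)"
  using Ck_within_has_derivative_D has_derivative_linear by blast

lemma Ck_within_D:
  assumes "Ck_within (Suc k) F M" "Ck_within k V M" "\<And>q. q \<in> M \<Longrightarrow> V q \<in> T q"
  shows "Ck_within k (\<lambda>q. D F q (V q)) M"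
proof -
  obtain f' where f': "\<And>x. x \<in> M \<Longrightarrow> (F has_derivative f' x) (at x within M)"
    "\<And>v. Ck_within k (\<lambda>x. f' x v) M"
    using assms(1) by (rule Ck_within_SucE) blast
  have "Ck_within k (\<lambda>q. f' q (V q)) M"
    by (rule Ck_within_linear_family[OF has_derivative_linear[OF f'(1)] f'(2) assms(2)])
  then show ?thesis
    by (rule Ck_within_eqI) (use D_eq[OF f'(1)] assms(3) in auto)
qed

text \<open>For tangent X and v this is the second fundamental form of M in the Euclidean space. For
  tangent X and normal v it is the shape operator; see \<open>dP_base\<close> and
  \<open>dP_\<xi>\<close>.\<close>

definition dP :: "'a \<Rightarrow> 'a \<Rightarrow> 'a \<Rightarrow> 'a" where
  "dP q X v = D (\<lambda>q. P q v) q X"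

lemma has_derivative_dP:
  "q \<in> M \<Longrightarrow> ((\<lambda>q. P q v) has_derivative (\<lambda>X. dP q X v)) (at q within M)"
  unfolding dP_def by (rule Ck_within_has_derivative_D[OF Ck_within_P])

lemma linear_dP_left: "q \<in> M \<Longrightarrow> linear (\<lambda>X. dP q X v)"
  using has_derivative_dP has_derivative_linear by blast

lemma linear_dP:
  assumes "q \<in> M" "X \<in> T q"
  shows "linear (dP q X)"
proof (rule linearI)
  fix v w c
  have "((\<lambda>q. P q v + P q w) has_derivative (\<lambda>X. dP q X v + dP q X w)) (at q within M)"
    by (intro has_derivative_add has_derivative_dP assms)
  then have "((\<lambda>q. P q (v + w)) has_derivative (\<lambda>X. dP q X v + dP q X w)) (at q within M)"
    by (rule has_derivative_transform[OF assms(1), rotated]) (simp add: linear_add[OF linear_P])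
  then show "dP q X (v + w) = dP q X v + dP q X w"
    using D_eq assms(2) by (metis dP_def)
  have "((\<lambda>q. c *\<^sub>R P q v) has_derivative (\<lambda>X. c *\<^sub>R dP q X v)) (at q within M)"
    by (intro has_derivative_scaleR_right has_derivative_dP assms)
  then have "((\<lambda>q. P q (c *\<^sub>R v)) has_derivative (\<lambda>X. c *\<^sub>R dP q X v)) (at q within M)"
    by (rule has_derivative_transform[OF assms(1), rotated]) (simp add: linear_scale[OF linear_P])
  then show "dP q X (c *\<^sub>R v) = c *\<^sub>R dP q X v"
    using D_eq assms(2) by (metis dP_def)
qed

lemma has_derivative_P_family:
  assumes V: "(V has_derivative V') (at p within M)" and p: "p \<in> M"
  shows "((\<lambda>q. P q (V q)) has_derivative (\<lambda>X. (\<Sum>b\<in>Basis. (V p \<bullet> b) *\<^sub>R dP p X b) + P p (V' X)))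
    (at p within M)"
proof -
  have "((\<lambda>q. \<Sum>b\<in>Basis. (V q \<bullet> b) *\<^sub>R P q b) has_derivative
      (\<lambda>X. \<Sum>b\<in>Basis. (V p \<bullet> b) *\<^sub>R dP p X b + (V' X \<bullet> b) *\<^sub>R P p b)) (at p within M)"
    by (intro has_derivative_sum has_derivative_scaleR has_derivative_inner_left V has_derivative_dP p)
  then have "((\<lambda>q. P q (V q)) has_derivative
      (\<lambda>X. \<Sum>b\<in>Basis. (V p \<bullet> b) *\<^sub>R dP p X b + (V' X \<bullet> b) *\<^sub>R P p b)) (at p within M)"
    by (rule has_derivative_transform[OF p, rotated]) (rule linear_euclidean_sum[OF linear_P])
  moreover have "(\<Sum>b\<in>Basis. (V p \<bullet> b) *\<^sub>R dP p X b + (V' X \<bullet> b) *\<^sub>R P p b)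
      = (\<Sum>b\<in>Basis. (V p \<bullet> b) *\<^sub>R dP p X b) + P p (V' X)" for X
    using linear_euclidean_sum[OF linear_P[OF p], of "V' X"] by (simp add: sum.distrib)
  ultimately show ?thesis by simp
qed

lemma D_P:
  assumes V: "(V has_derivative V') (at p within M)" and p: "p \<in> M" and X: "X \<in> T p"
  shows "D (\<lambda>q. P q (V q)) p X = dP p X (V p) + P p (V' X)"
  using D_eq[OF has_derivative_P_family[OF V p] X] linear_euclidean_sum[OF linear_dP[OF p X], of "V p"]
  by simp

text \<open>Differentiating P P = P gives dP = dP P + P dP; on a tangent Y the first two terms
  cancel. In other words, the canonical extension of Y has zero covariant derivative at p.\<close>

lemma P_dP_tangent:
  assumes "p \<in> M" "X \<in> T p" "Y \<in> T p"
  shows "P p (dP p X Y) = 0"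
proof -
  have "((\<lambda>q. P q (P q Y)) has_derivative (\<lambda>X. dP p X Y)) (at p within M)"
    by (rule has_derivative_transform[OF assms(1) _ has_derivative_dP[OF assms(1)]]) simp
  then have "D (\<lambda>q. P q (P q Y)) p X = dP p X Y" by (rule D_eq[OF _ assms(2)])
  then show ?thesis
    using D_P[OF has_derivative_dP[OF assms(1), of Y] assms(1,2)] P_id[OF assms(1,3)] by simp
qed

lemma dP_self_adjoint:
  assumes "p \<in> M" "X \<in> T p"
  shows "dP p X v \<bullet> w = v \<bullet> dP p X w"
proof -
  have "((\<lambda>q. v \<bullet> P q w) has_derivative (\<lambda>X. v \<bullet> dP p X w)) (at p within M)"
    by (intro has_derivative_inner_right has_derivative_dP assms)
  moreover have "((\<lambda>q. v \<bullet> P q w) has_derivative (\<lambda>X. dP p X v \<bullet> w)) (at p within M)"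
  proof (rule has_derivative_transform[OF assms(1)])
    show "((\<lambda>q. P q v \<bullet> w) has_derivative (\<lambda>X. dP p X v \<bullet> w)) (at p within M)"
      by (intro has_derivative_inner_left has_derivative_dP assms)
  qed (simp add: P_self_adjoint)
  ultimately show ?thesis using D_eq assms(2) by metis
qed

text \<open>Through r, the function F becomes an ordinary function G = F o r on an open set, and Q
  is the usual second derivative of G at p. Symmetry and the sign at a maximum are thus inherited
  from Euclidean calculus. The remaining term is the product rule applied to the moving direction
  \<open>P q Y\<close>.\<close>

lemma second_derivative_decomposition:
  fixes F :: "'a \<Rightarrow> real"
  assumes p: "p \<in> M" "p \<in> W" and retr: "local_retraction m M W r r'"
    and F: "Ck_within (Suc (Suc 0)) F M"
  obtains Q where "\<And>X Y. Q X Y = Q Y X"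
    and "\<And>X Y. X \<in> T p \<Longrightarrow> Y \<in> T p \<Longrightarrow>
      D (\<lambda>q. D F q (P q Y)) p X = D F p (r' p (dP p X Y)) + Q X Y"
    and "\<And>X. (\<And>q. q \<in> M \<Longrightarrow> F q \<le> F p) \<Longrightarrow> X \<in> T p \<Longrightarrow> D F p X = 0 \<and> Q X X \<le> 0"
proof -
  note R = local_retractionD[OF retr]
  define G where "G = (\<lambda>x. F (r x))"
  have "Ck_within (Suc (Suc 0)) G W"
    unfolding G_def by (rule Ck_within_compose[OF F R(2,5)])
  then obtain G' where "\<And>x. x \<in> W \<Longrightarrow> (G has_derivative G' x) (at x within W)"
      and G'1: "\<And>v. Ck_within (Suc 0) (\<lambda>x. G' x v) W"
    by (rule Ck_within_SucE) blast
  then have G': "(G has_derivative G' x) (at x)" if "x \<in> W" for x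
    using that R(1) by (metis at_within_open)
  have "\<exists>H. \<forall>x\<in>W. ((\<lambda>x. G' x v) has_derivative H x) (at x within W) \<and> (\<forall>w. continuous_on W (\<lambda>x. H x w))" for v
    using G'1[of v] by (auto elim!: Ck_within_SucE)
  then obtain H where H: "\<And>v x. x \<in> W \<Longrightarrow> ((\<lambda>x. G' x v) has_derivative H v x) (at x within W)"
      "\<And>v w x. x \<in> W \<Longrightarrow> continuous_on W (\<lambda>x. H v x w)"
    by metis
  have H1: "((\<lambda>x. G' x v) has_derivative H v x) (at x)" if "x \<in> W" for x v
    using H(1) that R(1) by (metis at_within_open)
  have FG: "(F has_derivative G' q) (at q within M)" if "q \<in> M" "q \<in> W" for q
  proof -
    have "(G has_derivative G' q) (at q within M \<inter> W)"
      using G'[OF that(2)] by (rule has_derivative_at_withinI)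
    then have "(F has_derivative G' q) (at q within M \<inter> W)"
      by (rule has_derivative_transform[rotated 2]) (use that R(6) in \<open>auto simp: G_def\<close>)
    then show ?thesis using at_within_Int_nhd[OF R(1) that(2)] by simp
  qed
  have G'p: "G' p v = D F p (r' p v)" for v
  proof -
    have "(F has_derivative D F p) (at (r p) within r ` W)"
      using Ck_within_has_derivative_D[OF F p(1)] R(5,6) p by (auto intro: has_derivative_subset)
    from has_derivative_in_compose[OF has_derivative_at_withinI[OF R(4)[OF p(2)]] this]
    have "(G has_derivative (\<lambda>v. D F p (r' p v))) (at p within W)" by (simp add: G_def)
    then show ?thesis
      using has_derivative_unique[OF G'[OF p(2)]] at_within_open[OF p(2) R(1)] by metis
  qed
  have H_linear: "(\<Sum>b\<in>Basis. (Y \<bullet> b) *\<^sub>R H b p X) = H Y p X" for X Y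
  proof -
    have "((\<lambda>x. \<Sum>b\<in>Basis. (Y \<bullet> b) *\<^sub>R G' x b) has_derivative (\<lambda>X. \<Sum>b\<in>Basis. (Y \<bullet> b) *\<^sub>R H b p X)) (at p)"
      by (intro has_derivative_sum has_derivative_scaleR_right H1 p)
    then have "((\<lambda>x. G' x Y) has_derivative (\<lambda>X. \<Sum>b\<in>Basis. (Y \<bullet> b) *\<^sub>R H b p X)) (at p)"
      by (rule has_derivative_transform_within_open[OF _ R(1) p(2)])
        (rule linear_euclidean_sum[OF has_derivative_linear[OF G'], symmetric])
    then show ?thesis using has_derivative_unique[OF H1[OF p(2)]] by metis
  qed
  show thesis
  proof (rule that[of "\<lambda>X Y. H Y p X"])
    show "H Y p X = H X p Y" for X Y
      using second_derivative_symmetric[OF R(1) p(2) G' H1 H1 H(2)[OF p(2)] H(2)[OF p(2)]] by blast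
  next
    fix X Y assume XY: "X \<in> T p" "Y \<in> T p"
    have "((\<lambda>q. \<Sum>b\<in>Basis. (P q Y \<bullet> b) *\<^sub>R G' q b) has_derivative
        (\<lambda>X. \<Sum>b\<in>Basis. (P p Y \<bullet> b) *\<^sub>R H b p X + (dP p X Y \<bullet> b) *\<^sub>R G' p b)) (at p within M)"
      by (intro has_derivative_sum has_derivative_scaleR has_derivative_inner_left has_derivative_dP p
          has_derivative_at_withinI[OF H1])
    then have "((\<lambda>q. \<Sum>b\<in>Basis. (P q Y \<bullet> b) *\<^sub>R G' q b) has_derivative
        (\<lambda>X. \<Sum>b\<in>Basis. (P p Y \<bullet> b) *\<^sub>R H b p X + (dP p X Y \<bullet> b) *\<^sub>R G' p b)) (at p within M \<inter> W)"
      by (rule has_derivative_subset) auto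
    then have "((\<lambda>q. D F q (P q Y)) has_derivative
        (\<lambda>X. \<Sum>b\<in>Basis. (P p Y \<bullet> b) *\<^sub>R H b p X + (dP p X Y \<bullet> b) *\<^sub>R G' p b)) (at p within M \<inter> W)"
    proof (rule has_derivative_transform[rotated 2])
      fix q assume q: "q \<in> M \<inter> W"
      then have "D F q (P q Y) = G' q (P q Y)" by (intro D_P_eq FG) auto
      also have "\<dots> = (\<Sum>b\<in>Basis. (P q Y \<bullet> b) *\<^sub>R G' q b)"
        using q by (intro linear_euclidean_sum has_derivative_linear[OF G']) auto
      finally show "D F q (P q Y) = (\<Sum>b\<in>Basis. (P q Y \<bullet> b) *\<^sub>R G' q b)" .
    qed (use p in auto)
    then have "D (\<lambda>q. D F q (P q Y)) p X
        = (\<Sum>b\<in>Basis. (P p Y \<bullet> b) *\<^sub>R H b p X + (dP p X Y \<bullet> b) *\<^sub>R G' p b)"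
      unfolding at_within_Int_nhd[OF R(1) p(2)] by (rule D_eq[OF _ XY(1)])
    also have "\<dots> = H Y p X + G' p (dP p X Y)"
      unfolding sum.distrib P_id[OF p(1) XY(2)] H_linear
      using linear_euclidean_sum[OF has_derivative_linear[OF G'[OF p(2)]], of "dP p X Y"] by simp
    finally show "D (\<lambda>q. D F q (P q Y)) p X = D F p (r' p (dP p X Y)) + H Y p X"
      by (simp add: G'p)
  next
    fix X assume max: "\<And>q. q \<in> M \<Longrightarrow> F q \<le> F p" and X: "X \<in> T p"
    have Gmax: "G x \<le> G p" if "x \<in> W" for x
      using max R(5,6) that p by (auto simp: G_def)
    have "G' p = (\<lambda>v. 0)"
      using differential_zero_maxmin[OF p(2) R(1) G'[OF p(2)]] Gmax by blast
    moreover have "D F p X = G' p X" using D_eq[OF FG[OF p] X] .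
    moreover have "H X p X \<le> 0"
      by (rule second_derivative_test[OF R(1) p(2) G' H1[OF p(2)] Gmax])
    ultimately show "D F p X = 0 \<and> H X p X \<le> 0" by simp
  qed
qed

text \<open>Apply the decomposition to the linear functions x \<bullet> b. As Q is symmetric, the
  difference Z of the two sides satisfies Z = r' p Z, so Z is tangent; but it is also normal by
  \<open>P_dP_tangent\<close>.\<close>

lemma dP_sym:
  assumes p: "p \<in> M" and X: "X \<in> T p" and Y: "Y \<in> T p"
  shows "dP p X Y = dP p Y X"
proof -
  obtain W r r' where W: "p \<in> W" "local_retraction m M W r r'"
    using local_retraction_exists[OF smooth p] .
  define Z where "Z = dP p X Y - dP p Y X"
  note lin = local_retractionD(8)[OF W(2,1)]
  have "Z \<bullet> b = r' p Z \<bullet> b" for b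
  proof -
    define F where "F = (\<lambda>x::'a. x \<bullet> b)"
    have F: "Ck_within k F M" for k
      unfolding F_def by (rule Ck_within_linear) (rule bounded_linear_inner_left)
    have "(F has_derivative F) (at q within M)" for q
      unfolding F_def by (intro has_derivative_inner_left has_derivative_ident)
    then have DF: "D F q v = v \<bullet> b" if "v \<in> T q" for q v
      using D_eq that unfolding F_def by blast
    obtain Q where Q: "\<And>X Y. Q X Y = Q Y X" "\<And>X Y. X \<in> T p \<Longrightarrow> Y \<in> T p \<Longrightarrow>
        D (\<lambda>q. D F q (P q Y)) p X = D F p (r' p (dP p X Y)) + Q X Y"
      using second_derivative_decomposition[OF p W(1,2) F] by metis
    have "D (\<lambda>q. D F q (P q Y)) p X = dP p X Y \<bullet> b" if "X \<in> T p" for X Y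
    proof (rule D_eq[OF _ that])
      have "((\<lambda>q. P q Y \<bullet> b) has_derivative (\<lambda>X. dP p X Y \<bullet> b)) (at p within M)"
        by (intro has_derivative_inner_left has_derivative_dP p)
      then show "((\<lambda>q. D F q (P q Y)) has_derivative (\<lambda>X. dP p X Y \<bullet> b)) (at p within M)"
        by (rule has_derivative_transform[OF p, rotated]) (simp add: DF P_in_T)
    qed
    then have "dP p X Y \<bullet> b - dP p Y X \<bullet> b = D F p (r' p (dP p X Y)) - D F p (r' p (dP p Y X))"
      using Q X Y by simp
    also have "\<dots> = r' p (dP p X Y) \<bullet> b - r' p (dP p Y X) \<bullet> b"
      using tangent_space_eq_range[OF W(2) p W(1)] by (simp add: DF)
    finally show ?thesis by (simp add: Z_def inner_diff_left linear_diff[OF lin])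
  qed
  then have "Z = r' p Z" by (metis vector_eq_rdot)
  then have "Z \<in> T p" using tangent_space_eq_range[OF W(2) p W(1)] by (metis rangeI)
  moreover have "P p Z = 0"
    unfolding Z_def using P_dP_tangent p X Y by (simp add: linear_diff[OF linear_P])
  ultimately show ?thesis using P_id[OF p] by (simp add: Z_def)
qed

text \<open>Since \<open>P q Y\<close> is covariantly constant at p, the two sides are the Hessian
  of F. Both terms of the decomposition are symmetric, the first one by
  \<open>dP_sym\<close>.\<close>

lemma second_derivative_sym:
  fixes F :: "'a \<Rightarrow> real"
  assumes p: "p \<in> M" and F: "Ck_within (Suc (Suc 0)) F M" and X: "X \<in> T p" and Y: "Y \<in> T p"
  shows "D (\<lambda>q. D F q (P q Y)) p X = D (\<lambda>q. D F q (P q X)) p Y"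
proof -
  obtain W r r' where W: "p \<in> W" "local_retraction m M W r r'"
    using local_retraction_exists[OF smooth p] .
  obtain Q where "\<And>X Y. Q X Y = Q Y X" "\<And>X Y. X \<in> T p \<Longrightarrow> Y \<in> T p \<Longrightarrow>
      D (\<lambda>q. D F q (P q Y)) p X = D F p (r' p (dP p X Y)) + Q X Y"
    using second_derivative_decomposition[OF p W(1,2) F] by metis
  then show ?thesis using X Y dP_sym[OF p X Y] by metis
qed

lemma derivatives_at_max:
  fixes F :: "'a \<Rightarrow> real"
  assumes p: "p \<in> M" and F: "Ck_within (Suc (Suc 0)) F M" and X: "X \<in> T p"
    and max: "\<And>q. q \<in> M \<Longrightarrow> F q \<le> F p"
  shows "D F p X = 0" and "D (\<lambda>q. D F q (P q X)) p X \<le> 0"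
proof -
  obtain W r r' where W: "p \<in> W" "local_retraction m M W r r'"
    using local_retraction_exists[OF smooth p] .
  obtain Q where Q: "\<And>X Y. X \<in> T p \<Longrightarrow> Y \<in> T p \<Longrightarrow>
      D (\<lambda>q. D F q (P q Y)) p X = D F p (r' p (dP p X Y)) + Q X Y"
      "\<And>X. (\<And>q. q \<in> M \<Longrightarrow> F q \<le> F p) \<Longrightarrow> X \<in> T p \<Longrightarrow> D F p X = 0 \<and> Q X X \<le> 0"
    using second_derivative_decomposition[OF p W(1,2) F] by metis
  show "D F p X = 0" using Q(2)[OF max X] by blast
  have "r' p v \<in> T p" for v using tangent_space_eq_range[OF W(2) p W(1)] by blast
  then have "D F p (r' p (dP p X X)) = 0" using Q(2)[OF max] by blast
  then show "D (\<lambda>q. D F q (P q X)) p X \<le> 0" using Q(1)[OF X X] Q(2)[OF max X] by simp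
qed

text \<open>Pulled back by r to a ball of the ambient space, F has zero derivative, and a ball is
  convex.\<close>

lemma locally_constant_if_D_zero:
  fixes F :: "'a \<Rightarrow> real"
  assumes p: "p \<in> M" and F: "Ck_within (Suc 0) F M" and V: "open V" "p \<in> V"
    and zero: "\<And>q X. q \<in> M \<Longrightarrow> q \<in> V \<Longrightarrow> X \<in> T q \<Longrightarrow> D F q X = 0"
  obtains U where "open U" "p \<in> U" "\<And>q. q \<in> M \<Longrightarrow> q \<in> U \<Longrightarrow> F q = F p"
proof -
  obtain W r r' where W: "p \<in> W" "local_retraction m M W r r'"
    using local_retraction_exists[OF smooth p] .
  note R = local_retractionD[OF W(2)]
  have "open (W \<inter> r -` V)"
    using R(1) V(1) Ck_within_imp_continuous_on[OF R(2)] by (simp add: continuous_open_preimage)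
  moreover have "p \<in> W \<inter> r -` V" using W V R(6)[OF p] by simp
  ultimately obtain e where e: "e > 0" "ball p e \<subseteq> W \<inter> r -` V"
    unfolding open_contains_ball by blast
  have "((\<lambda>x. F (r x)) has_derivative (\<lambda>h. 0)) (at x within ball p e)" if x: "x \<in> ball p e" for x
  proof -
    have xW: "x \<in> W" "r x \<in> V" "r x \<in> M" using x e R(5) by (auto simp: subset_iff image_subset_iff)
    have "(F has_derivative D F (r x)) (at (r x) within r ` ball p e)"
      using Ck_within_has_derivative_D[OF F xW(3)] R(5) e by (rule_tac has_derivative_subset) auto
    from has_derivative_in_compose[OF has_derivative_at_withinI[OF R(4)[OF xW(1)]] this]
    have "((\<lambda>x. F (r x)) has_derivative (\<lambda>v. D F (r x) (r' x v))) (at x within ball p e)" .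
    then show ?thesis
      using zero[OF xW(3,2) local_retraction_tangent[OF W(2) xW(1)]] by simp
  qed
  from has_derivative_zero_constant[OF convex_ball this]
  obtain c where c: "\<And>x. x \<in> ball p e \<Longrightarrow> F (r x) = c" by blast
  show thesis
  proof (rule that[of "ball p e"])
    show "F q = F p" if "q \<in> M" "q \<in> ball p e" for q
      using c[of q] c[of p] that e R(6) p W(1) by (auto simp: subset_iff)
  qed (use e in auto)
qed

end

section \<open>Submanifolds of the sphere\<close>

lemma subspace_orthogonal_complement: "subspace {v::'a::euclidean_space. v \<bullet> p = 0}"
  by (auto simp: subspace_def inner_add_left)

lemma orth_proj_hyperplane:
  fixes p :: "'a::euclidean_space"
  assumes "norm p = 1"
  shows "orth_proj {v. v \<bullet> p = 0} v = v - (v \<bullet> p) *\<^sub>R p"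
proof (rule orth_proj_eqI[OF subspace_orthogonal_complement])
  show "v - (v \<bullet> p) *\<^sub>R p \<in> {v. v \<bullet> p = 0}"
    using assms by (simp add: inner_diff_left norm_eq_1)
qed (simp add: inner_commute)

lemma tangent_space_sphere:
  fixes p :: "'a::euclidean_space"
  assumes "norm p = 1"
  shows "tangent_space (sphere 0 1) p = {v. v \<bullet> p = 0}"
proof (intro equalityI subsetI)
  fix v assume "v \<in> tangent_space (sphere 0 1) p"
  then obtain \<gamma> where \<gamma>: "range \<gamma> \<subseteq> sphere 0 1" "\<gamma> 0 = p" "(\<gamma> has_vector_derivative v) (at (0::real))"
    by (auto simp: tangent_space_def)
  have "((\<lambda>t. \<gamma> t \<bullet> \<gamma> t) has_derivative (\<lambda>t. \<gamma> 0 \<bullet> (t *\<^sub>R v) + (t *\<^sub>R v) \<bullet> \<gamma> 0)) (at 0)"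
    using \<gamma>(3) unfolding has_vector_derivative_def by (intro has_derivative_inner)
  moreover have "(\<lambda>t. \<gamma> t \<bullet> \<gamma> t) = (\<lambda>t. 1)"
    using \<gamma>(1) by (force simp: norm_eq_1[symmetric])
  ultimately have "(\<lambda>t. \<gamma> 0 \<bullet> (t *\<^sub>R v) + (t *\<^sub>R v) \<bullet> \<gamma> 0) = (\<lambda>t. 0)"
    using has_derivative_unique[OF _ has_derivative_const] by metis
  from fun_cong[OF this, of 1] show "v \<in> {v. v \<bullet> p = 0}" by (simp add: \<gamma>(2) inner_commute)
next
  fix v assume "v \<in> {v. v \<bullet> p = 0}"
  then have v: "v \<bullet> p = 0" by simp
  have p: "p \<bullet> p = 1" using assms by (simp add: norm_eq_1)
  \<comment> \<open>The squared length of p + t v, as v is orthogonal to the unit vector p; the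
    curve is this line normalised.\<close>
  define n where "n = (\<lambda>t::real. 1 + t\<^sup>2 * (v \<bullet> v))"
  have n: "n t > 0" for t by (simp add: n_def add_pos_nonneg)
  define \<gamma> where "\<gamma> = (\<lambda>t::real. (n t powr (- 1/2)) *\<^sub>R (p + t *\<^sub>R v))"
  have "(p + t *\<^sub>R v) \<bullet> (p + t *\<^sub>R v) = n t" for t
    using v p by (simp add: n_def inner_add_left inner_add_right inner_commute[of p v]
        power2_eq_square)
  then have "\<gamma> t \<bullet> \<gamma> t = (n t powr (- 1/2)) * (n t powr (- 1/2)) * n t" for t
    by (simp add: \<gamma>_def)
  also have "(n t powr (- 1/2)) * (n t powr (- 1/2)) * n t = 1" for t
    using n[of t] powr_add[of "n t" "- 1/2" "- 1/2"] by (simp add: powr_minus_divide)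
  finally have "norm (\<gamma> t) = 1" for t by (simp add: norm_eq_1)
  moreover have "\<gamma> 0 = p" by (simp add: \<gamma>_def n_def)
  moreover have "(\<gamma> has_vector_derivative v) (at 0)"
  proof -
    have "((\<lambda>t. n t powr (- 1/2)) has_real_derivative 0) (at 0)"
      unfolding n_def by (auto intro!: derivative_eq_intros)
    moreover have "((\<lambda>t::real. p + t *\<^sub>R v) has_vector_derivative v) (at 0)"
      by (auto intro!: derivative_eq_intros simp: has_vector_derivative_def)
    ultimately have "(\<gamma> has_vector_derivative n 0 powr (- 1/2) *\<^sub>R v + 0 *\<^sub>R (p + 0 *\<^sub>R v)) (at 0)"
      unfolding \<gamma>_def by (intro has_vector_derivative_scaleR)
    then show ?thesis by (simp add: n_def)
  qed
  ultimately show "v \<in> tangent_space (sphere 0 1) p"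
    by (auto simp: tangent_space_def intro!: exI[of _ \<gamma>])
qed

lemma nabla_sphere:
  fixes p :: "'a::euclidean_space"
  assumes "norm p = 1"
  shows "nabla (sphere 0 1) M V p X
    = frechet_derivative V (at p within M) X - (frechet_derivative V (at p within M) X \<bullet> p) *\<^sub>R p"
  by (simp add: nabla_def tangent_space_sphere orth_proj_hyperplane assms)

lemma extension_sphere:
  fixes q :: "'a::euclidean_space"
  assumes "norm q = 1"
  shows "extension (sphere 0 1) X q = X - (X \<bullet> q) *\<^sub>R q"
  by (simp add: extension_def tangent_space_sphere orth_proj_hyperplane assms)

lemma has_derivative_extension_sphere:
  fixes q :: "'a::euclidean_space"
  assumes "norm q = 1"
  shows "(extension (sphere 0 1) X has_derivative (\<lambda>v. - ((X \<bullet> q) *\<^sub>R v + (X \<bullet> v) *\<^sub>R q)))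
    (at q within sphere 0 1)"
proof -
  have "((\<lambda>q. X - (X \<bullet> q) *\<^sub>R q) has_derivative (\<lambda>v. - ((X \<bullet> q) *\<^sub>R v + (X \<bullet> v) *\<^sub>R q)))
      (at q within sphere 0 1)"
    by (auto intro!: derivative_eq_intros)
  then show ?thesis
    by (rule has_derivative_transform[rotated 2]) (use assms in \<open>auto simp: extension_sphere\<close>)
qed

text \<open>The extension of Z is the gradient of the linear function with vector Z, and its
  covariant derivative along a tangent Y at q is -(Z \<bullet> q) Y. The coefficient vanishes at p,
  so a further derivative along X leaves only -(X \<bullet> Z) Y, and the bracket of two extensions
  is 0 at p.\<close>

lemma curvature_sphere:
  fixes p :: "'a::euclidean_space"
  assumes p: "norm p = 1" and XYZ: "X \<bullet> p = 0" "Y \<bullet> p = 0" "Z \<bullet> p = 0"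
  shows "curvature (sphere 0 1) p X Y Z = (Y \<bullet> Z) *\<^sub>R X - (X \<bullet> Z) *\<^sub>R Y"
proof -
  let ?S = "sphere 0 1 :: 'a set"
  note fd = frechet_derivative_within_eq[OF has_derivative_extension_sphere]
  have ext_T: "extension ?S Y q \<in> tangent_space ?S q" if "norm q = 1" for q Y
    using that by (simp add: extension_sphere tangent_space_sphere inner_diff_left norm_eq_1)
  have ext_p: "extension ?S Y p = Y" if "Y \<bullet> p = 0" for Y
    using that p by (simp add: extension_sphere)
  have first: "nabla ?S ?S (extension ?S Z) q (extension ?S Y q) = - ((Z \<bullet> q) *\<^sub>R (Y - (Y \<bullet> q) *\<^sub>R q))"
    if q: "norm q = 1" for q Y
  proof -
    define y where "y = extension ?S Y q"
    have y: "y \<bullet> q = 0" using ext_T[OF q, of Y] tangent_space_sphere[OF q] by (simp add: y_def)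
    have "frechet_derivative (extension ?S Z) (at q within ?S) y = - ((Z \<bullet> q) *\<^sub>R y + (Z \<bullet> y) *\<^sub>R q)"
      unfolding y_def by (rule fd[OF q ext_T[OF q]])
    then have "nabla ?S ?S (extension ?S Z) q y = - ((Z \<bullet> q) *\<^sub>R y)"
      using y q by (simp add: nabla_sphere[OF q] inner_diff_left norm_eq_1)
    then show ?thesis by (simp add: y_def extension_sphere[OF q])
  qed
  have second: "nabla ?S ?S (\<lambda>q. nabla ?S ?S (extension ?S Z) q (extension ?S Y q)) p X = - ((X \<bullet> Z) *\<^sub>R Y)"
    if XY: "X \<bullet> p = 0" "Y \<bullet> p = 0" for X Y
  proof -
    have "((\<lambda>q. - ((Z \<bullet> q) *\<^sub>R (Y - (Y \<bullet> q) *\<^sub>R q))) has_derivative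
        (\<lambda>v. - ((Z \<bullet> p) *\<^sub>R (- ((Y \<bullet> p) *\<^sub>R v + (Y \<bullet> v) *\<^sub>R p)) + (Z \<bullet> v) *\<^sub>R (Y - (Y \<bullet> p) *\<^sub>R p)))) (at p within ?S)"
      by (auto intro!: derivative_eq_intros)
    then have "((\<lambda>q. nabla ?S ?S (extension ?S Z) q (extension ?S Y q)) has_derivative
        (\<lambda>v. - ((Z \<bullet> p) *\<^sub>R (- ((Y \<bullet> p) *\<^sub>R v + (Y \<bullet> v) *\<^sub>R p)) + (Z \<bullet> v) *\<^sub>R (Y - (Y \<bullet> p) *\<^sub>R p)))) (at p within ?S)"
      by (rule has_derivative_transform[rotated 2]) (use p first in auto)
    from frechet_derivative_within_eq[OF this, of X]
    show ?thesis
      using XY XYZ p by (simp add: nabla_sphere tangent_space_sphere inner_commute)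
  qed
  have "frechet_derivative (extension ?S Y) (at p within ?S) X = - ((Y \<bullet> X) *\<^sub>R p)"
    if "X \<bullet> p = 0" "Y \<bullet> p = 0" for X Y
    using fd[OF p, of X Y] that p by (simp add: tangent_space_sphere)
  then have bracket: "lie_bracket ?S (extension ?S X) (extension ?S Y) p = 0"
    using XYZ by (simp add: lie_bracket_def ext_p inner_commute)
  have "frechet_derivative (extension ?S Z) (at p within ?S) 0 = 0"
    using fd[OF p, of 0 Z] p by (simp add: tangent_space_sphere)
  then have "nabla ?S ?S (extension ?S Z) p 0 = 0"
    by (simp add: nabla_sphere[OF p])
  then show ?thesis
    using XYZ by (simp add: curvature_def curvature_field_def bracket ext_p second)
qed

locale sphere_submanifold = submanifold +
  assumes in_sphere: "M \<subseteq> sphere 0 1"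
begin

abbreviation S :: "'a set" where
  "S \<equiv> sphere 0 1"

lemma norm_M: "q \<in> M \<Longrightarrow> norm q = 1"
  using in_sphere by auto

lemma T_orthogonal: "q \<in> M \<Longrightarrow> X \<in> T q \<Longrightarrow> X \<bullet> q = 0"
  using in_sphere tangent_space_sphere[OF norm_M] by (force simp: tangent_space_def)

lemma P_base [simp]: "q \<in> M \<Longrightarrow> P q q = 0"
  using P_eq_0 T_orthogonal by (metis inner_commute)

lemma nabla_eq: "q \<in> M \<Longrightarrow> nabla S M V q X = D V q X - (D V q X \<bullet> q) *\<^sub>R q"
  by (simp add: nabla_sphere norm_M D_def)

lemma extension_eq: "extension M Y = (\<lambda>q. P q Y)"
  by (simp add: extension_def P_def)

lemma D_zero_on:
  assumes "\<And>q. q \<in> M \<Longrightarrow> F q = c" "p \<in> M" "X \<in> T p"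
  shows "D F p X = 0"
proof (rule D_eq[OF _ assms(3)])
  show "(F has_derivative (\<lambda>_. 0)) (at p within M)"
    by (rule has_derivative_transform[OF assms(2) _ has_derivative_const[of c]]) (use assms in auto)
qed

text \<open>Differentiate P q q = 0: the position vector is normal to M and has derivative X along
  X.\<close>

lemma dP_base:
  assumes "p \<in> M" "X \<in> T p"
  shows "dP p X p = - X"
proof -
  have "D (\<lambda>q. P q q) p X = 0" by (rule D_zero_on[OF _ assms]) simp
  then show ?thesis
    using D_P[OF has_derivative_ident assms] P_id[OF assms] by (simp add: eq_neg_iff_add_eq_0)
qed

lemma normal_space_eq:
  "q \<in> M \<Longrightarrow> normal_space S M q = {v. v \<bullet> q = 0 \<and> (\<forall>w\<in>T q. v \<bullet> w = 0)}"
  by (auto simp: normal_space_def tangent_space_sphere norm_M orthogonal_def)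

lemma subspace_normal_space: "q \<in> M \<Longrightarrow> subspace (normal_space S M q)"
  by (auto simp: normal_space_eq subspace_def inner_add_left)

lemma orth_proj_normal_space:
  assumes "q \<in> M"
  shows "orth_proj (normal_space S M q) v = v - P q v - (v \<bullet> q) *\<^sub>R q"
proof (rule orth_proj_eqI[OF subspace_normal_space[OF assms]])
  have Pq: "P q v \<bullet> q = 0" using T_orthogonal P_in_T assms by blast
  have "(v - P q v - (v \<bullet> q) *\<^sub>R q) \<bullet> w = 0" if "w \<in> T q" for w
    using that by (simp add: inner_diff_left P_inner assms inner_commute[of q] T_orthogonal)
  moreover have "q \<bullet> q = 1" using norm_M[OF assms] by (simp add: norm_eq_1)
  ultimately show "v - P q v - (v \<bullet> q) *\<^sub>R q \<in> normal_space S M q"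
    by (simp add: normal_space_eq[OF assms] inner_diff_left Pq)
  fix w assume "w \<in> normal_space S M q"
  then have "w \<bullet> q = 0" "w \<bullet> P q v = 0"
    using P_in_T[OF assms] by (auto simp: normal_space_eq[OF assms])
  then show "(v - (v - P q v - (v \<bullet> q) *\<^sub>R q)) \<bullet> w = 0"
    by (simp add: inner_add_right inner_commute[of _ w])
qed

text \<open>\<open>dP p X Y\<close> is already normal to M, with radial component -(X \<bullet> Y)
  by \<open>dP_base\<close>; removing that component gives the form inside the sphere.\<close>

lemma second_fundamental_form_eq:
  assumes "p \<in> M" "X \<in> T p" "Y \<in> T p"
  shows "second_fundamental_form S M p X Y = dP p X Y + (X \<bullet> Y) *\<^sub>R p"
proof -
  have "dP p X Y \<bullet> p = - (X \<bullet> Y)"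
    using dP_self_adjoint[OF assms(1,2), of Y p] dP_base[OF assms(1,2)] by (simp add: inner_commute)
  then show ?thesis
    using assms P_dP_tangent[OF assms] linear_P[OF assms(1)] norm_M[OF assms(1)]
    by (simp add: second_fundamental_form_def nabla_eq extension_eq orth_proj_normal_space
        dP_def[symmetric] linear_add linear_diff linear_scale inner_add_left norm_eq_1)
qed

section \<open>The mean curvature vector and the biharmonic equation in the sphere\<close>

definition basis_T :: "'a \<Rightarrow> 'a set" where
  "basis_T q = (SOME E. orthonormal_basis (T q) E)"

lemma basis_T: "q \<in> M \<Longrightarrow> orthonormal_basis (T q) (basis_T q)"
  unfolding basis_T_def by (rule orthonormal_basis_exists[OF subspace_T])

lemmas basis_TD = orthonormal_basisD[OF basis_T]

definition H :: "'a \<Rightarrow> 'a" where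
  "H = mean_curvature_vector m S M"

lemma H_eq:
  assumes "q \<in> M"
  shows "H q = (\<Sum>e\<in>basis_T q. dP q e e + (e \<bullet> e) *\<^sub>R q) /\<^sub>R real m"
proof -
  have "(\<Sum>e\<in>basis_T q. second_fundamental_form S M q e e)
      = (\<Sum>e\<in>basis_T q. dP q e e + (e \<bullet> e) *\<^sub>R q)"
    using basis_TD(2)[OF assms] by (intro sum.cong refl second_fundamental_form_eq assms) auto
  then show ?thesis
    unfolding H_def mean_curvature_vector_def trace_on_def basis_T_def by simp
qed

lemma H_normal:
  assumes "q \<in> M"
  shows "H q \<in> normal_space S M q"
proof -
  have "second_fundamental_form S M q X Y \<in> normal_space S M q" for X Y
    unfolding second_fundamental_form_def by (rule orth_proj_in[OF subspace_normal_space[OF assms]])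
  then show ?thesis
    unfolding H_def mean_curvature_vector_def trace_on_def
    by (intro subspace_scale subspace_sum subspace_normal_space assms)
qed

lemma trace_basis_T:
  assumes "q \<in> M" "orthonormal_basis UNIV F" "\<And>x. linear (\<beta> x)" "\<And>y. linear (\<lambda>x. \<beta> x y)"
  shows "(\<Sum>b\<in>F. \<beta> (P q b) (P q b)) = (\<Sum>e\<in>basis_T q. \<beta> e e)"
  unfolding P_def by (rule sum_orth_proj_eq_trace[OF basis_T[OF assms(1)] assms(2-4)])

text \<open>The bases chosen at different points need not vary continuously, so the trace is
  rewritten over the fixed standard basis, projected by P.\<close>

lemma Ck_within_H: "Ck_within k H M"
proof (rule Ck_within_eqI)
  have "Ck_within k (\<lambda>q. dP q (P q b) (P q b)) M" for b
  proof (rule Ck_within_linear_family[where F = "\<lambda>q. dP q (P q b)"])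
    show "linear (dP q (P q b))" if "q \<in> M" for q
      using that by (intro linear_dP P_in_T)
    show "Ck_within k (\<lambda>q. dP q (P q b) c) M" for c
      unfolding dP_def by (intro Ck_within_D Ck_within_P P_in_T)
  qed (rule Ck_within_P)
  then show "Ck_within k (\<lambda>q. (inverse (real m)) *\<^sub>R
      (\<Sum>b\<in>Basis. dP q (P q b) (P q b) + (P q b \<bullet> P q b) *\<^sub>R q)) M"
    by (intro Ck_within_scaleR Ck_within_const Ck_within_sum Ck_within_add Ck_within_inner
        Ck_within_P Ck_within_id)
  fix q assume q: "q \<in> M"
  \<comment> \<open>The extra P makes the form bilinear on the whole space, since linearity of
    \<open>dP q X\<close> is available only for tangent X.\<close>
  have "(\<Sum>b\<in>Basis. dP q (P q (P q b)) (P q b) + (P q b \<bullet> P q b) *\<^sub>R q)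
      = (\<Sum>e\<in>basis_T q. dP q (P q e) e + (e \<bullet> e) *\<^sub>R q)"
  proof (rule trace_basis_T[OF q orthonormal_basis_Basis,
        where \<beta> = "\<lambda>x y. dP q (P q x) y + (x \<bullet> y) *\<^sub>R q"])
    show "linear (\<lambda>y. dP q (P q x) y + (x \<bullet> y) *\<^sub>R q)" for x
      using linear_dP[OF q P_in_T[OF q, of x]]
      by (intro linearI) (simp_all add: linear_add linear_scale inner_add_right algebra_simps)
    show "linear (\<lambda>x. dP q (P q x) y + (x \<bullet> y) *\<^sub>R q)" for y
      using linear_add[OF linear_dP_left[OF q, of y]] linear_scale[OF linear_dP_left[OF q, of y]]
        linear_P[OF q]
      by (intro linearI) (simp_all add: linear_add linear_scale inner_add_left algebra_simps)
  qed
  moreover have "(\<Sum>e\<in>basis_T q. dP q (P q e) e + (e \<bullet> e) *\<^sub>R q)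
      = (\<Sum>e\<in>basis_T q. dP q e e + (e \<bullet> e) *\<^sub>R q)"
    using P_id[OF q basis_TD(2)[OF q]] by (intro sum.cong) auto
  ultimately show "H q = (inverse (real m)) *\<^sub>R
      (\<Sum>b\<in>Basis. dP q (P q b) (P q b) + (P q b \<bullet> P q b) *\<^sub>R q)"
    using q by (simp add: H_eq)
qed

lemma D_inner:
  assumes "(V has_derivative V') (at p within M)" "(U has_derivative U') (at p within M)" "X \<in> T p"
  shows "D (\<lambda>q. V q \<bullet> U q) p X = V' X \<bullet> U p + V p \<bullet> U' X"
  using D_eq[OF has_derivative_inner[OF assms(1,2)] assms(3)] by simp

text \<open>Differentiate V \<bullet> q = 0 and use that V is orthogonal to X. For normal fields,
  the flat derivative along M is therefore already tangent to the sphere.\<close>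

lemma D_normal_field_inner_base:
  assumes p: "p \<in> M" and X: "X \<in> T p" and V: "(V has_derivative V') (at p within M)"
    and normal: "\<And>q. q \<in> M \<Longrightarrow> V q \<in> normal_space S M q"
  shows "V' X \<bullet> p = 0"
proof -
  have "D (\<lambda>q. V q \<bullet> q) p X = 0"
    using normal normal_space_eq by (intro D_zero_on[OF _ p X]) auto
  moreover have "V p \<bullet> X = 0" using normal[OF p] X normal_space_eq[OF p] by auto
  ultimately show ?thesis using D_inner[OF V has_derivative_ident X] by simp
qed

text \<open>The connection term drops out by \<open>P_dP_tangent\<close>, and the inner derivative
  needs no projection because H is normal; only the outer projection to the sphere remains.\<close>

lemma second_covariant_derivative_H:
  assumes p: "p \<in> M" and e: "e \<in> T p"
  shows "second_covariant_derivative S M H p e e =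
    D (\<lambda>q. D H q (P q e)) p e - (D (\<lambda>q. D H q (P q e)) p e \<bullet> p) *\<^sub>R p"
proof -
  have "nabla M M (extension M e) p e = 0"
    using P_dP_tangent[OF p e e]
    by (simp add: nabla_def extension_eq dP_def D_def P_def)
  moreover have "D H p 0 = 0" using linear_D[OF Ck_within_H p] by (simp add: linear_0)
  ultimately have 1: "nabla S M H p (nabla M M (extension M e) p e) = 0"
    by (simp add: nabla_eq p)
  have 2: "nabla S M H q (extension M e q) = D H q (P q e)" if q: "q \<in> M" for q
    using D_normal_field_inner_base[OF q P_in_T[OF q, of e] Ck_within_has_derivative_D[OF Ck_within_H q] H_normal]
    by (simp add: nabla_eq q extension_eq)
  have "((\<lambda>q. D H q (P q e)) has_derivative D (\<lambda>q. D H q (P q e)) p) (at p within M)"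
    by (rule Ck_within_has_derivative_D[OF Ck_within_D[OF Ck_within_H Ck_within_P P_in_T] p])
  then have "((\<lambda>q. nabla S M H q (extension M e q)) has_derivative D (\<lambda>q. D H q (P q e)) p) (at p within M)"
    by (rule has_derivative_transform[OF p, rotated]) (rule 2)
  then have 3: "D (\<lambda>q. nabla S M H q (extension M e q)) p e = D (\<lambda>q. D H q (P q e)) p e"
    by (rule D_eq[OF _ e])
  show ?thesis
    unfolding second_covariant_derivative_def 1 diff_zero by (simp only: nabla_eq[OF p] 3)
qed

text \<open>Each unit tangent e contributes -H to the curvature term, m times in total. Pairing with
  Y orthogonal to p discards the radial parts, which leaves flat derivatives only.\<close>

lemma biharmonic_inner:
  assumes bi: "biharmonic m S M" and p: "p \<in> M" and Y: "Y \<bullet> p = 0"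
  shows "(\<Sum>e\<in>basis_T p. D (\<lambda>q. D H q (P q e)) p e \<bullet> Y) = - real m * (H p \<bullet> Y)"
proof -
  let ?W = "\<lambda>e. D (\<lambda>q. D H q (P q e)) p e"
  have "- (\<Sum>e\<in>basis_T p. second_covariant_derivative S M H p e e)
      + (\<Sum>e\<in>basis_T p. curvature S p e (H p) e) = 0"
    using bi p unfolding biharmonic_def rough_laplacian_def trace_on_def basis_T_def H_def by blast
  moreover have "second_covariant_derivative S M H p e e = ?W e - (?W e \<bullet> p) *\<^sub>R p"
    if "e \<in> basis_T p" for e
    using second_covariant_derivative_H[OF p] basis_TD(2)[OF p that] by blast
  moreover have "curvature S p e (H p) e = - H p" if "e \<in> basis_T p" for e
  proof -
    have "e \<in> T p" "e \<bullet> e = 1" using basis_TD(2,3)[OF p that] by auto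
    moreover have "H p \<bullet> p = 0" "H p \<bullet> e = 0"
      using H_normal[OF p] \<open>e \<in> T p\<close> by (auto simp: normal_space_eq[OF p])
    ultimately show ?thesis
      using curvature_sphere[OF norm_M[OF p], of e "H p" e] T_orthogonal[OF p] by simp
  qed
  ultimately have "- (\<Sum>e\<in>basis_T p. ?W e - (?W e \<bullet> p) *\<^sub>R p) - real m *\<^sub>R H p = 0"
    using basis_TD(6)[OF p] dim_T[OF p] by (simp add: sum_negf sum_constant_scaleR)
  then have "(- (\<Sum>e\<in>basis_T p. ?W e - (?W e \<bullet> p) *\<^sub>R p) - real m *\<^sub>R H p) \<bullet> Y = 0"
    by simp
  then show ?thesis
    using Y by (simp add: inner_diff_left inner_sum_left inner_commute[of p])
qed

end

section \<open>PNMC biharmonic submanifolds\<close>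

locale pnmc_submanifold = sphere_submanifold +
  assumes m_ge: "m \<ge> 2" and pnmc: "PNMC m S M"
begin

definition f :: "'a \<Rightarrow> real" where
  "f = mean_curvature m S M"

definition \<xi> :: "'a \<Rightarrow> 'a" where
  "\<xi> = (\<lambda>q. H q /\<^sub>R f q)"

text \<open>The shape operator in the direction \<open>\<xi>\<close>; it is minus the derivative of \<open>\<xi>\<close> because
  \<open>\<xi>\<close> is parallel.\<close>

definition A :: "'a \<Rightarrow> 'a \<Rightarrow> 'a" where
  "A q X = - D \<xi> q X"

lemma f_eq: "f q = norm (H q)"
  by (simp add: f_def H_def mean_curvature_def)

lemma f_pos: "q \<in> M \<Longrightarrow> f q > 0"
  using pnmc by (simp add: PNMC_def f_def)

lemma H_eq_f_\<xi>: "q \<in> M \<Longrightarrow> H q = f q *\<^sub>R \<xi> q"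
  using f_pos by (force simp: \<xi>_def)

lemma \<xi>_normal: "q \<in> M \<Longrightarrow> \<xi> q \<in> normal_space S M q"
  unfolding \<xi>_def by (intro subspace_scale subspace_normal_space H_normal)

lemma \<xi>_inner [simp]: "q \<in> M \<Longrightarrow> \<xi> q \<bullet> q = 0" "q \<in> M \<Longrightarrow> w \<in> T q \<Longrightarrow> \<xi> q \<bullet> w = 0"
  using \<xi>_normal by (auto simp: normal_space_eq)

lemma \<xi>_unit: "q \<in> M \<Longrightarrow> \<xi> q \<bullet> \<xi> q = 1"
  using f_pos[of q] by (simp add: \<xi>_def f_eq flip: norm_eq_1 del: inner_scaleR_left inner_scaleR_right)

lemma Ck_within_f_powr: "Ck_within k (\<lambda>q. (H q \<bullet> H q) powr a) M"
proof (rule Ck_within_compose[OF Ck_within_powr])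
  show "Ck_within k (\<lambda>q. H q \<bullet> H q) M" by (intro Ck_within_inner Ck_within_H)
  show "(\<lambda>q. H q \<bullet> H q) ` M \<subseteq> {0<..}" using f_pos by (force simp: f_eq)
qed

lemma Ck_within_f: "Ck_within k f M"
proof (rule Ck_within_eqI[OF Ck_within_f_powr])
  show "f q = (H q \<bullet> H q) powr (1/2)" if "q \<in> M" for q
    by (simp add: f_eq norm_eq_sqrt_inner powr_half_sqrt)
qed

lemma Ck_within_\<xi>: "Ck_within k \<xi> M"
proof (rule Ck_within_eqI[OF Ck_within_scaleR[OF Ck_within_f_powr Ck_within_H]])
  show "\<xi> q = (H q \<bullet> H q) powr (- (1/2)) *\<^sub>R H q" if "q \<in> M" for q
    by (simp add: \<xi>_def f_eq norm_eq_sqrt_inner powr_half_sqrt powr_minus)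
qed

lemmas der_\<xi> = Ck_within_has_derivative_D[OF Ck_within_\<xi>]
  and der_f = Ck_within_has_derivative_D[OF Ck_within_f]

lemma linear_A: "q \<in> M \<Longrightarrow> linear (A q)"
  unfolding A_def using linear_D[OF Ck_within_\<xi>] by (intro linear_compose_neg)

text \<open>Here the parallelism of \<open>\<xi>\<close> enters: its derivative has no component
  normal to M in the sphere, and none along q because \<open>\<xi>\<close> is orthogonal to the
  position vector.\<close>

lemma A_in_T:
  assumes q: "q \<in> M" and X: "X \<in> T q"
  shows "A q X \<in> T q"
proof -
  have 0: "D \<xi> q X \<bullet> q = 0"
    using D_normal_field_inner_base[OF q X der_\<xi>[OF q] \<xi>_normal] .
  have "normal_connection S M \<xi> q X = 0"
    using pnmc q X by (simp add: PNMC_def parallel_normal_def \<xi>_def H_def f_def)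
  then have "D \<xi> q X - P q (D \<xi> q X) = 0"
    using 0 by (simp add: normal_connection_def orth_proj_normal_space[OF q] nabla_eq[OF q])
  then have "D \<xi> q X \<in> T q" using P_in_T[OF q] by (metis eq_iff_diff_eq_0)
  then show ?thesis unfolding A_def by (rule subspace_neg[OF subspace_T[OF q]])
qed

lemma Ck_within_A: "Ck_within k (\<lambda>q. A q (P q Y)) M"
  unfolding A_def by (rule Ck_within_uminus[OF Ck_within_D[OF Ck_within_\<xi> Ck_within_P P_in_T]])

lemma der_A_inner:
  assumes "p \<in> M"
  shows "((\<lambda>q. A q (P q Y) \<bullet> P q X) has_derivative D (\<lambda>q. A q (P q Y) \<bullet> P q X) p) (at p within M)"
  by (rule Ck_within_has_derivative_D[OF Ck_within_inner[OF Ck_within_A Ck_within_P] assms])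

text \<open>Differentiate P q (\<xi> q) = 0. Paired with a second vector, this is the Weingarten
  relation between A and the second fundamental form.\<close>

lemma dP_\<xi>:
  assumes q: "q \<in> M" and X: "X \<in> T q"
  shows "dP q X (\<xi> q) = A q X"
proof -
  have "D (\<lambda>q. P q (\<xi> q)) q X = 0"
    using P_eq_0 \<xi>_inner(2) by (intro D_zero_on[OF _ q X]) auto
  moreover have "P q (D \<xi> q X) = - A q X"
    using P_id[OF q A_in_T[OF q X]] linear_neg[OF linear_P[OF q], of "A q X"] by (simp add: A_def)
  ultimately show ?thesis using D_P[OF der_\<xi>[OF q] q X] by simp
qed

lemma \<xi>_dP:
  assumes q: "q \<in> M" and X: "X \<in> T q"
  shows "\<xi> q \<bullet> dP q X Y = A q X \<bullet> Y"
  using dP_self_adjoint[OF q X, of "\<xi> q" Y] dP_\<xi>[OF q X] by simp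

lemma A_sym:
  assumes "q \<in> M" "X \<in> T q" "Y \<in> T q"
  shows "A q X \<bullet> Y = X \<bullet> A q Y"
  using \<xi>_dP[OF assms(1,2), of Y] \<xi>_dP[OF assms(1,3), of X] dP_sym[OF assms]
  by (simp add: inner_commute)

lemma trace_A:
  assumes "q \<in> M"
  shows "(\<Sum>e\<in>basis_T q. A q e \<bullet> e) = real m * f q"
proof -
  have "(\<Sum>e\<in>basis_T q. A q e \<bullet> e) = (\<Sum>e\<in>basis_T q. (dP q e e + (e \<bullet> e) *\<^sub>R q) \<bullet> \<xi> q)"
    using basis_TD(2)[OF assms] assms
    by (intro sum.cong refl)
      (simp add: \<xi>_dP[symmetric] inner_add_right inner_commute[of _ "\<xi> q"])
  also have "\<dots> = (real m *\<^sub>R H q) \<bullet> \<xi> q"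
    using m_ge by (simp add: H_eq[OF assms] inner_sum_left)
  also have "\<dots> = real m * f q"
    by (simp add: H_eq_f_\<xi>[OF assms] \<xi>_unit[OF assms])
  finally show ?thesis .
qed

lemma D_H:
  assumes q: "q \<in> M" and X: "X \<in> T q"
  shows "D H q X = D f q X *\<^sub>R \<xi> q - f q *\<^sub>R A q X"
proof (rule D_eq[OF _ X, THEN trans])
  show "(H has_derivative (\<lambda>X. f q *\<^sub>R D \<xi> q X + D f q X *\<^sub>R \<xi> q)) (at q within M)"
    by (rule has_derivative_transform[OF q H_eq_f_\<xi> has_derivative_scaleR[OF der_f[OF q] der_\<xi>[OF q]]])
qed (simp add: A_def)

lemma der_DH:
  assumes "p \<in> M"
  shows "((\<lambda>q. D H q (P q Y)) has_derivative D (\<lambda>q. D H q (P q Y)) p) (at p within M)"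
  by (rule Ck_within_has_derivative_D[OF Ck_within_D[OF Ck_within_H Ck_within_P P_in_T] assms])

lemma der_D\<xi>:
  assumes "p \<in> M"
  shows "((\<lambda>q. D \<xi> q (P q Y)) has_derivative D (\<lambda>q. D \<xi> q (P q Y)) p) (at p within M)"
  by (rule Ck_within_has_derivative_D[OF Ck_within_D[OF Ck_within_\<xi> Ck_within_P P_in_T] assms])

lemma D_A_inner:
  assumes p: "p \<in> M" and Z: "Z \<in> T p"
  shows "D (\<lambda>q. A q (P q Y) \<bullet> P q X) p Z
    = - (D (\<lambda>q. D \<xi> q (P q Y)) p Z \<bullet> P p X) + A p (P p Y) \<bullet> dP p Z X"
  using D_inner[OF has_derivative_minus[OF der_D\<xi>[OF p, of Y]] has_derivative_dP[OF p, of X] Z]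
  by (simp add: A_def)

text \<open>A Y is tangent and \<open>dP p Z X\<close> is normal. Hence for tangent arguments the
  last term of \<open>D_A_inner\<close> vanishes, and the derivative there is the covariant
  derivative of A.\<close>

lemma A_inner_dP:
  assumes "p \<in> M" "X \<in> T p" "Y \<in> T p" "Z \<in> T p"
  shows "A p Y \<bullet> dP p Z X = 0"
proof -
  have "A p Y \<bullet> dP p Z X = P p (A p Y) \<bullet> dP p Z X"
    using P_id A_in_T assms by simp
  then show ?thesis
    using P_dP_tangent[OF assms(1,4,2)] by (simp add: P_self_adjoint[OF assms(1)])
qed

text \<open>The Codazzi equation: in the sphere, \<open>\<nabla>A\<close> is symmetric because \<open>\<xi>\<close> is parallel.\<close>

lemma codazzi:
  assumes p: "p \<in> M" and X: "X \<in> T p" and Y: "Y \<in> T p" and Z: "Z \<in> T p"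
  shows "D (\<lambda>q. A q (P q Y) \<bullet> P q X) p Z = D (\<lambda>q. A q (P q Z) \<bullet> P q X) p Y"
proof -
  \<comment> \<open>Freezing X reduces the claim to the symmetry of the Hessian of a real
    function.\<close>
  define F where "F = (\<lambda>q. \<xi> q \<bullet> X)"
  have F: "Ck_within k F M" for k
    unfolding F_def by (intro Ck_within_inner Ck_within_\<xi> Ck_within_const)
  have "D F q v = D \<xi> q v \<bullet> X" if "q \<in> M" "v \<in> T q" for q v
    unfolding F_def by (rule D_eq[OF has_derivative_inner_left[OF der_\<xi>[OF that(1)]] that(2)])
  then have DF: "D F q (P q W) = D \<xi> q (P q W) \<bullet> X" if "q \<in> M" for q W
    using that P_in_T by blast
  have "D (\<lambda>q. D F q (P q W)) p V = D (\<lambda>q. D \<xi> q (P q W)) p V \<bullet> X" if "V \<in> T p" for V W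
  proof (rule D_eq[OF _ that])
    show "((\<lambda>q. D F q (P q W)) has_derivative (\<lambda>V. D (\<lambda>q. D \<xi> q (P q W)) p V \<bullet> X)) (at p within M)"
      by (rule has_derivative_transform[OF p DF has_derivative_inner_left[OF der_D\<xi>[OF p]]])
  qed
  then have "D (\<lambda>q. D \<xi> q (P q Y)) p Z \<bullet> X = D (\<lambda>q. D \<xi> q (P q Z)) p Y \<bullet> X"
    using second_derivative_sym[OF p F Z Y] Y Z by simp
  then show ?thesis
    using A_inner_dP p X Y Z by (simp add: D_A_inner P_id)
qed

text \<open>The divergence of A is m times the gradient of f: by Codazzi and the symmetry of A, the
  sum is the derivative of the trace of A along X.\<close>

lemma trace_codazzi:
  assumes p: "p \<in> M" and X: "X \<in> T p"
  shows "(\<Sum>e\<in>basis_T p. D (\<lambda>q. A q (P q e) \<bullet> P q X) p e) = real m * D f p X"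
proof -
  let ?E = "basis_T p"
  note E = basis_TD[OF p]
  \<comment> \<open>A trace is differentiated over a fixed basis of the whole space, chosen adapted
    to p: a tangent basis together with one of the orthogonal complement. The vectors b of the
    latter have P p b = 0, so their terms have zero derivative at p.\<close>
  define N where "N = {v. \<forall>w\<in>T p. v \<bullet> w = 0}"
  have "subspace N" by (auto simp: N_def subspace_def inner_add_left)
  then obtain E' where E': "orthonormal_basis N E'"
    using orthonormal_basis_exists by blast
  note E'D = orthonormal_basisD[OF E']
  have disj: "?E \<inter> E' = {}"
    using E(2,3) E'D(2) by (force simp: N_def)
  have F: "orthonormal_basis UNIV (?E \<union> E')"
    unfolding orthonormal_basis_def
  proof (intro conjI)
    have "x \<bullet> y = 0" "y \<bullet> x = 0" if "x \<in> ?E" "y \<in> E'" for x y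
      using E(2)[OF that(1)] E'D(2)[OF that(2)] by (auto simp: N_def inner_commute)
    then have "orthogonal x y" if "x \<in> ?E \<union> E'" "y \<in> ?E \<union> E'" "x \<noteq> y" for x y
      using that E(4) E'D(4) unfolding orthogonal_def by blast
    then show "pairwise orthogonal (?E \<union> E')" by (simp add: pairwise_def)
    show "\<forall>e\<in>?E \<union> E'. norm e = 1" using E(3) E'D(3) by (auto simp: norm_eq_1)
    have "v \<in> span (?E \<union> E')" for v
    proof -
      have "P p v \<in> span ?E" using P_in_T[OF p] basis_T[OF p] by (simp add: orthonormal_basis_def)
      moreover have "v - P p v \<in> N" by (simp add: N_def inner_diff_left P_inner p)
      then have "v - P p v \<in> span E'" using E' by (simp add: orthonormal_basis_def)
      ultimately have "P p v + (v - P p v) \<in> span (?E \<union> E')"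
        by (meson span_add span_mono sup_ge1 sup_ge2 subsetD)
      then show ?thesis by simp
    qed
    then show "span (?E \<union> E') = UNIV" by blast
  qed auto
  have mf: "real m * f q = (\<Sum>b\<in>?E \<union> E'. A q (P q b) \<bullet> P q b)" if q: "q \<in> M" for q
    unfolding trace_A[OF q, symmetric]
    by (rule trace_basis_T[OF q F, where \<beta> = "\<lambda>x y. A q x \<bullet> y", symmetric])
      (auto intro!: linearI simp: inner_add_left inner_add_right linear_add linear_scale linear_A[OF q])
  have "((\<lambda>q. \<Sum>b\<in>?E \<union> E'. A q (P q b) \<bullet> P q b) has_derivative
      (\<lambda>X. \<Sum>b\<in>?E \<union> E'. D (\<lambda>q. A q (P q b) \<bullet> P q b) p X)) (at p within M)"
    by (intro has_derivative_sum der_A_inner p)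
  then have sum: "((\<lambda>q. real m * f q) has_derivative
      (\<lambda>X. \<Sum>b\<in>?E \<union> E'. D (\<lambda>q. A q (P q b) \<bullet> P q b) p X)) (at p within M)"
    by (rule has_derivative_transform[OF p, rotated]) (rule mf)
  have "((\<lambda>q. real m * f q) has_derivative (\<lambda>X. real m * D f p X)) (at p within M)"
    by (intro has_derivative_mult_right der_f p)
  from D_eq[OF this X] have "real m * D f p X = (\<Sum>b\<in>?E \<union> E'. D (\<lambda>q. A q (P q b) \<bullet> P q b) p X)"
    using D_eq[OF sum X] by simp
  also have "\<dots> = (\<Sum>b\<in>?E. D (\<lambda>q. A q (P q b) \<bullet> P q b) p X)
      + (\<Sum>b\<in>E'. D (\<lambda>q. A q (P q b) \<bullet> P q b) p X)"
    by (rule sum.union_disjoint[OF E(1) E'D(1) disj])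
  also have "(\<Sum>b\<in>E'. D (\<lambda>q. A q (P q b) \<bullet> P q b) p X) = 0"
  proof (rule sum.neutral, rule ballI)
    fix b assume "b \<in> E'"
    then have "P p b = 0" using E'D(2) P_eq_0[OF p] by (auto simp: N_def)
    then show "D (\<lambda>q. A q (P q b) \<bullet> P q b) p X = 0"
      by (simp add: D_A_inner p X linear_0[OF linear_A[OF p]])
  qed
  also have "(\<Sum>b\<in>?E. D (\<lambda>q. A q (P q b) \<bullet> P q b) p X)
      = (\<Sum>e\<in>?E. D (\<lambda>q. A q (P q e) \<bullet> P q X) p e)"
  proof (rule sum.cong[OF refl])
    fix e assume "e \<in> ?E"
    then have e: "e \<in> T p" by (rule E(2))
    have "D (\<lambda>q. A q (P q e) \<bullet> P q e) p X = D (\<lambda>q. A q (P q X) \<bullet> P q e) p e"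
      by (rule codazzi[OF p e e X])
    also have "\<dots> = D (\<lambda>q. A q (P q e) \<bullet> P q X) p e"
    proof -
      have "((\<lambda>q. A q (P q X) \<bullet> P q e) has_derivative D (\<lambda>q. A q (P q e) \<bullet> P q X) p) (at p within M)"
        by (rule has_derivative_transform[OF p _ der_A_inner[OF p]])
          (metis A_sym P_in_T inner_commute)
      from D_eq[OF this e] show ?thesis .
    qed
    finally show "D (\<lambda>q. A q (P q e) \<bullet> P q e) p X = D (\<lambda>q. A q (P q e) \<bullet> P q X) p e" .
  qed
  finally show ?thesis by simp
qed

definition norm_A_sq :: "'a \<Rightarrow> real" where
  "norm_A_sq q = (\<Sum>e\<in>basis_T q. A q e \<bullet> A q e)"

lemma continuous_on_norm_A_sq: "continuous_on M norm_A_sq"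
proof -
  have "Ck_within 0 (\<lambda>q. \<Sum>b\<in>Basis. A q (P q b) \<bullet> A q (P q b)) M"
    by (intro Ck_within_sum Ck_within_inner Ck_within_A)
  moreover have "norm_A_sq q = (\<Sum>b\<in>Basis. A q (P q b) \<bullet> A q (P q b))" if q: "q \<in> M" for q
    unfolding norm_A_sq_def
    by (rule trace_basis_T[OF q orthonormal_basis_Basis, where \<beta> = "\<lambda>x y. A q x \<bullet> A q y", symmetric])
      (auto intro!: linearI simp: inner_add_left inner_add_right linear_add linear_scale linear_A[OF q])
  ultimately have "Ck_within 0 norm_A_sq M" by (rule Ck_within_eqI)
  then show ?thesis by simp
qed

text \<open>Without the gradient term, the derivative of H is -f A X, which is tangent to M and so
  has no normal part.\<close>

lemma PMC_if_D_f_zero: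
  assumes "\<And>q X. q \<in> M \<Longrightarrow> X \<in> T q \<Longrightarrow> D f q X = 0"
  shows "PMC m S M"
  unfolding PMC_def parallel_normal_def H_def[symmetric]
proof (intro ballI)
  fix q X assume q: "q \<in> M" and X: "X \<in> T q"
  have DH: "D H q X = - f q *\<^sub>R A q X" using D_H[OF q X] assms[OF q X] by simp
  then have "D H q X \<in> T q"
    using A_in_T[OF q X] by (simp add: subspace_T q subspace_scale subspace_neg)
  then show "normal_connection S M H q X = 0"
    using T_orthogonal[OF q] P_id[OF q]
    by (simp add: normal_connection_def orth_proj_normal_space[OF q] nabla_eq[OF q])
qed

end

section \<open>Consequences of the biharmonic equation\<close>

locale pnmc_biharmonic_submanifold = pnmc_submanifold +
  assumes biharm: "biharmonic m S M"
begin

text \<open>Differentiate D f = D H \<bullet> \<xi> once more. The derivative falling on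
  \<open>\<xi>\<close> pairs -f A e with -A e and sums to f |A|^2; the derivative falling on D H is
  given by the biharmonic equation.\<close>

lemma laplacian_f:
  assumes p: "p \<in> M"
  shows "(\<Sum>e\<in>basis_T p. D (\<lambda>q. D f q (P q e)) p e) = (norm_A_sq p - real m) * f p"
proof -
  have step: "D (\<lambda>q. D f q (P q e)) p e = D (\<lambda>q. D H q (P q e)) p e \<bullet> \<xi> p + f p * (A p e \<bullet> A p e)"
    if "e \<in> basis_T p" for e
  proof -
    have e: "e \<in> T p" using basis_TD(2)[OF p that] .
    have DfH: "D f q (P q e) = D H q (P q e) \<bullet> \<xi> q" if q: "q \<in> M" for q
    proof -
      have "A q (P q e) \<bullet> \<xi> q = 0"
        using \<xi>_inner(2)[OF q A_in_T[OF q P_in_T[OF q]]] by (simp only: inner_commute)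
      then show ?thesis
        by (simp only: D_H[OF q P_in_T[OF q]] inner_diff_left inner_scaleR_left \<xi>_unit[OF q])
    qed
    have "((\<lambda>q. D f q (P q e)) has_derivative
        (\<lambda>v. D H p (P p e) \<bullet> D \<xi> p v + D (\<lambda>q. D H q (P q e)) p v \<bullet> \<xi> p)) (at p within M)"
      by (rule has_derivative_transform[OF p DfH has_derivative_inner[OF der_DH[OF p] der_\<xi>[OF p]]])
    from D_eq[OF this e]
    have "D (\<lambda>q. D f q (P q e)) p e = D H p e \<bullet> D \<xi> p e + D (\<lambda>q. D H q (P q e)) p e \<bullet> \<xi> p"
      by (simp add: P_id[OF p e])
    moreover have "D \<xi> p e = - A p e" by (simp add: A_def)
    moreover have "\<xi> p \<bullet> A p e = 0" using \<xi>_inner(2)[OF p A_in_T[OF p e]] .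
    ultimately show ?thesis by (simp add: D_H[OF p e] inner_diff_left)
  qed
  have "(\<Sum>e\<in>basis_T p. D (\<lambda>q. D H q (P q e)) p e \<bullet> \<xi> p) = - real m * f p"
    using biharmonic_inner[OF biharm p \<xi>_inner(1)[OF p]]
    by (simp add: H_eq_f_\<xi>[OF p] \<xi>_unit[OF p])
  then show ?thesis
    by (simp add: step sum.distrib sum_distrib_left[symmetric] norm_A_sq_def algebra_simps)
qed

text \<open>H is normal, so the traced second derivative of H has zero product with X. The term with
  D f and A appears twice: from differentiating the factor f of -f A, and from the turning of the
  tangent space against \<open>\<xi>\<close>. The term with the derivative of A is evaluated by
  \<open>trace_codazzi\<close>.\<close>

lemma D_f_A:
  assumes p: "p \<in> M" and X: "X \<in> T p"
  shows "D f p (A p X) = - (real m / 2) * f p * D f p X"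
proof -
  have step: "D (\<lambda>q. D H q (P q e)) p e \<bullet> X
      = - 2 * (D f p e * (e \<bullet> A p X)) - f p * D (\<lambda>q. A q (P q e) \<bullet> P q X) p e"
    if "e \<in> basis_T p" for e
  proof -
    have e: "e \<in> T p" using basis_TD(2)[OF p that] .
    have 1: "D H q (P q e) \<bullet> P q X = - (f q * (A q (P q e) \<bullet> P q X))" if q: "q \<in> M" for q
      using D_H[OF q P_in_T[OF q, of e]] \<xi>_inner(2)[OF q P_in_T[OF q, of X]]
      by (simp add: inner_diff_left)
    from has_derivative_minus[OF has_derivative_mult[OF der_f[OF p] der_A_inner[OF p, of e X]]]
    have "((\<lambda>q. D H q (P q e) \<bullet> P q X) has_derivative
        (\<lambda>v. - (f p * D (\<lambda>q. A q (P q e) \<bullet> P q X) p v + D f p v * (A p (P p e) \<bullet> P p X)))) (at p within M)"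
      by (rule has_derivative_transform[OF p, rotated]) (rule 1)
    from D_eq[OF this e]
    have "D (\<lambda>q. D H q (P q e) \<bullet> P q X) p e
        = - (f p * D (\<lambda>q. A q (P q e) \<bullet> P q X) p e) - D f p e * (e \<bullet> A p X)"
      using A_sym[OF p e X] by (simp add: P_id p e X)
    moreover have "D (\<lambda>q. D H q (P q e) \<bullet> P q X) p e
        = D (\<lambda>q. D H q (P q e)) p e \<bullet> X + D H p e \<bullet> dP p e X"
      using D_inner[OF der_DH[OF p] has_derivative_dP[OF p] e] by (simp add: P_id p e X)
    moreover have "D H p e \<bullet> dP p e X = D f p e * (e \<bullet> A p X)"
      using \<xi>_dP[OF p e, of X] A_inner_dP[OF p X e e] A_sym[OF p e X]
      by (simp add: D_H[OF p e] inner_diff_left)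
    ultimately show ?thesis by linarith
  qed
  have "X \<bullet> p = 0" "H p \<bullet> X = 0"
    using T_orthogonal[OF p X] \<xi>_inner(2)[OF p X] by (auto simp: H_eq_f_\<xi>[OF p])
  then have "(\<Sum>e\<in>basis_T p. D (\<lambda>q. D H q (P q e)) p e \<bullet> X) = 0"
    using biharmonic_inner[OF biharm p] by simp
  then have "0 = - 2 * (\<Sum>e\<in>basis_T p. D f p e * (e \<bullet> A p X)) - f p * (real m * D f p X)"
    by (simp add: step sum_subtractf sum_distrib_left[symmetric] sum_negf trace_codazzi[OF p X])
  moreover have "D f p (A p X) = (\<Sum>e\<in>basis_T p. D f p e * (e \<bullet> A p X))"
  proof -
    have lin: "linear (D f p)" by (rule linear_D[OF Ck_within_f p])
    have "D f p (A p X) = D f p (\<Sum>e\<in>basis_T p. (A p X \<bullet> e) *\<^sub>R e)"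
      using orthonormal_basis_expand[OF basis_T[OF p] A_in_T[OF p X]] by simp
    then show ?thesis
      by (simp add: linear_sum[OF lin] linear_scale[OF lin] inner_commute mult.commute)
  qed
  ultimately show ?thesis by (simp add: field_simps)
qed

text \<open>Where \<open>D f \<noteq> 0\<close>, the gradient of \<open>f\<close> is an eigenvector of \<open>A\<close> for \<open>-(m/2) f\<close>. As the trace
  of \<open>A\<close> is \<open>m f\<close>, the remaining eigenvalues have sum \<open>(3m/2) f\<close>.\<close>

lemma norm_A_sq_ge:
  assumes p: "p \<in> M" and Y: "Y \<in> T p" "D f p Y \<noteq> 0" and f_ge: "(f p)\<^sup>2 \<ge> 4 / real m"
  shows "norm_A_sq p \<ge> real m + 9"
proof -
  let ?E = "basis_T p"
  note E = basis_TD[OF p]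
  have lin: "linear (D f p)" by (rule linear_D[OF Ck_within_f p])
  \<comment> \<open>The gradient of f at p.\<close>
  define g where "g = (\<Sum>e\<in>?E. D f p e *\<^sub>R e)"
  have gT: "g \<in> T p" unfolding g_def using E(2) by (intro subspace_sum subspace_scale subspace_T p)
  have Dg: "D f p X = g \<bullet> X" if "X \<in> T p" for X
  proof -
    have "D f p X = D f p (\<Sum>e\<in>?E. (X \<bullet> e) *\<^sub>R e)"
      using orthonormal_basis_expand[OF basis_T[OF p] that] by simp
    then show ?thesis
      by (simp add: g_def inner_sum_left linear_sum[OF lin] linear_scale[OF lin] inner_commute[of X] mult.commute)
  qed
  have "g \<noteq> 0" using Dg[OF Y(1)] Y(2) by auto
  define l where "l = - (real m / 2) * f p"
  have Ag: "A p g = l *\<^sub>R g"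
  proof -
    have "A p g \<bullet> X = l * (g \<bullet> X)" if X: "X \<in> T p" for X
      unfolding A_sym[OF p gT X] Dg[OF A_in_T[OF p X], symmetric] Dg[OF X, symmetric] l_def
      by (rule D_f_A[OF p X])
    then have "(A p g - l *\<^sub>R g) \<bullet> X = 0" if X: "X \<in> T p" for X
      using X by (simp only: inner_diff_left inner_scaleR_left diff_self)
    moreover have "A p g - l *\<^sub>R g \<in> T p"
      using gT A_in_T[OF p gT] by (intro subspace_diff subspace_scale subspace_T p)
    ultimately show ?thesis by (metis inner_eq_zero_iff eq_iff_diff_eq_0)
  qed
  define u where "u = g /\<^sub>R norm g"
  have uT: "u \<in> T p" unfolding u_def using gT by (intro subspace_scale subspace_T p)
  have uu: "u \<bullet> u = 1" using \<open>g \<noteq> 0\<close> by (simp add: u_def dot_square_norm power2_eq_square)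
  have Au: "A p u = l *\<^sub>R u" by (simp add: u_def linear_scale[OF linear_A[OF p]] Ag)
  \<comment> \<open>The mean of the other m - 1 eigenvalues, whose sum is 3 m f / 2. With
    \<open>\<beta>\<close> chosen next, the operator \<alpha> I + \<beta> u u^T has the eigenvalue l
    at u and \<alpha> on its complement.\<close>
  define \<alpha> where "\<alpha> = 3 * real m * f p / (2 * (real m - 1))"
  define \<beta> where "\<beta> = l - \<alpha>"
  have m1: "real m - 1 > 0" using m_ge by simp
  have \<alpha>: "\<alpha> * (real m - 1) = real m * f p - l"
    using m1 by (simp add: \<alpha>_def l_def field_simps)
  have inner_square_diff: "(a - x *\<^sub>R e - y *\<^sub>R u) \<bullet> (a - x *\<^sub>R e - y *\<^sub>R u)
      = a \<bullet> a + x\<^sup>2 * (e \<bullet> e) + y\<^sup>2 * (u \<bullet> u) - 2 * x * (a \<bullet> e) - 2 * y * (a \<bullet> u) + 2 * x * y * (u \<bullet> e)"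
    for a e u :: 'a and x y :: real
    by (simp add: inner_diff_left inner_diff_right power2_eq_square inner_commute algebra_simps)
  have exp: "(A p e - \<alpha> *\<^sub>R e - (\<beta> * (u \<bullet> e)) *\<^sub>R u) \<bullet> (A p e - \<alpha> *\<^sub>R e - (\<beta> * (u \<bullet> e)) *\<^sub>R u)
      = A p e \<bullet> A p e + \<alpha>\<^sup>2 + \<beta>\<^sup>2 * ((u \<bullet> e) * (u \<bullet> e)) - 2 * \<alpha> * (A p e \<bullet> e)
        - 2 * \<beta> * l * ((u \<bullet> e) * (u \<bullet> e)) + 2 * \<alpha> * \<beta> * ((u \<bullet> e) * (u \<bullet> e))"
    if "e \<in> ?E" for e
  proof -
    have "A p e \<bullet> u = l * (u \<bullet> e)"
      using A_sym[OF p E(2)[OF that] uT] Au by (simp add: inner_commute)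
    then show ?thesis
      unfolding inner_square_diff E(3)[OF that] uu by (simp add: power2_eq_square)
  qed
  \<comment> \<open>The squared Frobenius norm of A - \<alpha> I - \<beta> u u^T. Its nonnegativity
    is the Cauchy-Schwarz bound for the other eigenvalues, obtained without diagonalising A.\<close>
  have "0 \<le> (\<Sum>e\<in>?E. (A p e - \<alpha> *\<^sub>R e - (\<beta> * (u \<bullet> e)) *\<^sub>R u) \<bullet> (A p e - \<alpha> *\<^sub>R e - (\<beta> * (u \<bullet> e)) *\<^sub>R u))"
    by (intro sum_nonneg) simp
  also have "\<dots> = norm_A_sq p + \<alpha>\<^sup>2 * real m + \<beta>\<^sup>2 - 2 * \<alpha> * (real m * f p) - 2 * \<beta> * l + 2 * \<alpha> * \<beta>"
    using orthonormal_basis_parseval[OF basis_T[OF p] uT, of u] uu E(6) dim_T[OF p]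
    by (simp add: exp sum.distrib sum_subtractf sum_distrib_left[symmetric] norm_A_sq_def
        trace_A[OF p])
  also have "\<dots> = norm_A_sq p - l\<^sup>2 + \<alpha>\<^sup>2 * (real m - 1) - 2 * \<alpha> * (real m * f p - l)"
    by (simp add: \<beta>_def power2_eq_square algebra_simps)
  also have "\<dots> = norm_A_sq p - l\<^sup>2 - \<alpha>\<^sup>2 * (real m - 1)"
    unfolding \<alpha>[symmetric] by (simp add: power2_eq_square algebra_simps)
  finally have "norm_A_sq p \<ge> l\<^sup>2 + \<alpha>\<^sup>2 * (real m - 1)" by simp
  \<comment> \<open>The constant 4/m is exactly the value of f^2 at which l^2 = m^2 f^2 / 4 equals
    m.\<close>
  moreover have "l\<^sup>2 \<ge> real m"
  proof -
    have "l\<^sup>2 = (real m)\<^sup>2 / 4 * (f p)\<^sup>2" by (simp add: l_def power2_eq_square)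
    also have "\<dots> \<ge> (real m)\<^sup>2 / 4 * (4 / real m)" by (intro mult_left_mono f_ge) simp
    also have "(real m)\<^sup>2 / 4 * (4 / real m) = real m" by (simp add: power2_eq_square)
    finally show ?thesis .
  qed
  \<comment> \<open>Since \<alpha> = -3 l / (m - 1), the left side is 9 l^2 / (m - 1), and l^2 is at
    least m.\<close>
  moreover have "\<alpha>\<^sup>2 * (real m - 1) \<ge> 9"
  proof -
    have "\<alpha> = - 3 * l / (real m - 1)" by (simp add: \<alpha>_def l_def)
    moreover have "(- 3 * l / c)\<^sup>2 * c = 9 * l\<^sup>2 / c" if "c > 0" for c :: real
      using that by (simp add: power2_eq_square)
    ultimately have "\<alpha>\<^sup>2 * (real m - 1) = 9 * l\<^sup>2 / (real m - 1)"
      using m1 by blast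
    moreover have "9 * (real m - 1) \<le> 9 * l\<^sup>2" using \<open>l\<^sup>2 \<ge> real m\<close> by simp
    ultimately show ?thesis using m1 by (simp add: pos_le_divide_eq)
  qed
  ultimately show ?thesis by simp
qed

lemma locally_constant_at_max:
  assumes p: "p \<in> M" and max: "\<And>q. q \<in> M \<Longrightarrow> f q \<le> f p"
    and f_ge: "\<And>q. q \<in> M \<Longrightarrow> (f q)\<^sup>2 \<ge> 4 / real m"
  obtains U where "open U" "p \<in> U" "\<And>q. q \<in> M \<Longrightarrow> q \<in> U \<Longrightarrow> f q = f p"
proof -
  have "(\<Sum>e\<in>basis_T p. D (\<lambda>q. D f q (P q e)) p e) \<le> 0"
    using derivatives_at_max(2)[OF p Ck_within_f _ max] basis_TD(2)[OF p] by (intro sum_nonpos) auto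
  then have "norm_A_sq p \<le> real m"
    using laplacian_f[OF p] f_pos[OF p] by (simp add: mult_le_0_iff)
  \<comment> \<open>|A|^2 is at most m at p, so by continuity it stays below m + 9 near p. There
    \<open>norm_A_sq_ge\<close> excludes a nonzero derivative of f.\<close>
  moreover have "openin (top_of_set M) (M \<inter> norm_A_sq -` {..<real m + 9})"
    by (rule continuous_openin_preimage_gen[OF continuous_on_norm_A_sq]) simp
  then obtain V where V: "open V" "M \<inter> norm_A_sq -` {..<real m + 9} = M \<inter> V"
    by (auto simp: openin_open)
  ultimately have "p \<in> V" using p by auto
  moreover have "D f q X = 0" if "q \<in> M" "q \<in> V" "X \<in> T q" for q X
  proof (rule ccontr)
    assume "D f q X \<noteq> 0"
    then have "norm_A_sq q \<ge> real m + 9" by (rule norm_A_sq_ge[OF that(1,3) _ f_ge[OF that(1)]])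
    moreover have "q \<in> M \<inter> norm_A_sq -` {..<real m + 9}" using V(2) that by blast
    ultimately show False by simp
  qed
  ultimately show thesis
    using locally_constant_if_D_zero[OF p Ck_within_f V(1)] that by blast
qed

lemma PMC_if_mean_curvature_ge:
  assumes "connected M" "compact M" and f_ge: "\<And>q. q \<in> M \<Longrightarrow> (f q)\<^sup>2 \<ge> 4 / real m"
  shows "PMC m S M"
proof (cases "M = {}")
  case True
  then show ?thesis by (simp add: PMC_def parallel_normal_def)
next
  case False
  have cont: "continuous_on M f" using Ck_within_f by (rule Ck_within_imp_continuous_on)
  obtain p where p: "p \<in> M" "\<And>q. q \<in> M \<Longrightarrow> f q \<le> f p"
    using continuous_attains_sup[OF assms(2) False cont] by blast
  let ?K = "M \<inter> f -` {f p}"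
  have "closedin (top_of_set M) ?K"
    by (rule continuous_closedin_preimage[OF cont]) simp
  moreover have "openin (top_of_set M) ?K"
  proof (subst openin_subopen, intro ballI)
    fix q assume q: "q \<in> ?K"
    \<comment> \<open>Every point of this level set is itself a maximum point, so local constancy
      holds around each of them.\<close>
    then obtain U where "open U" "q \<in> U" "\<And>x. x \<in> M \<Longrightarrow> x \<in> U \<Longrightarrow> f x = f q"
      using locally_constant_at_max[of q] p f_ge by auto
    then show "\<exists>T. openin (top_of_set M) T \<and> q \<in> T \<and> T \<subseteq> ?K"
      using q by (intro exI[of _ "M \<inter> U"]) (auto simp: openin_open_Int)
  qed
  ultimately have "?K = M" using assms(1) p(1) unfolding connected_clopen by blast
  then have "f q = f p" if "q \<in> M" for q using that by blast
  then show ?thesis by (intro PMC_if_D_f_zero D_zero_on)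
qed

end

theorem proposition3p3:
  fixes M :: "'a::euclidean_space set" and m n :: nat
  assumes "DIM('a) = n + 1"
    and "m \<ge> 5"
    and "M \<subseteq> sphere 0 1"
    and "smooth_submanifold m M"
    and "connected M"
    and "compact M"
    and "PNMC m (sphere 0 1) M"
    and "biharmonic m (sphere 0 1) M"
    and "\<And>p. p \<in> M \<Longrightarrow> (mean_curvature m (sphere 0 1) M p)\<^sup>2 \<ge> 4 / real m"
  shows "PMC m (sphere 0 1) M"
proof -
  interpret pnmc_biharmonic_submanifold m M
    using assms(2-4,7,8) by unfold_locales auto
  show ?thesis
    using assms(5,6,9) by (intro PMC_if_mean_curvature_ge) (simp_all add: f_def)
qed

end
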